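(* Let $G = H \wr \langle t \rangle$ be the restricted wreath product of a finitely generated group $H \neq 1$ and an infinite cyclic group $\langle t \rangle \cong C_\infty$. Then for every finite generating set $S$ of $G$ the degree of commutativity of $G$ with respect to $S$ is $\mathrm{dc}_S(G) = 0$.
   Context: The restricted (standard) wreath product $G = H \wr \langle t\rangle$ is the semidirect product $G = N \rtimes \langle t \rangle$, where the base group $N = \bigoplus_{i \in \mathbb{Z}} H^{t^i}$ is the direct sum of the conjugates $H^{t^i} = t^{-i} H t^i$ of $H$, $i \in \mathbb{Z}$. For a group $G$ with finite generating set $S$, $l_S(g)$ denotes the distance between $1$ and $g$ in the Cayley graph of $G$ with respect to $S$ (the word length of $g$ over $S \cup S^{-1}$), and $B_S(n) = \{ g \in G \mid l_S(g) \le n\}$ for $n \in \mathbb{N}_0$. The degree of commutativity of $G$ with respect to $S$ is $$\mathrm{dc}_S(G) = \limsup_{n \to \infty} \frac{|\{ (g,h) \in B_S(n) \times B_S(n) \mid gh = hg \}|}{|B_S(n)|^2}.$$ *)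

theory Defs
  imports
    "HOL-Algebra.Product_Groups"
    "HOL-Algebra.Generated_Groups"
    "HOL-Library.Extended_Real"
begin

definition semidirect_product ::
    "('a, 'c) monoid_scheme \<Rightarrow> ('b, 'd) monoid_scheme \<Rightarrow> ('b \<Rightarrow> 'a \<Rightarrow> 'a) \<Rightarrow> ('a \<times> 'b) monoid"
  where "semidirect_product N Q \<phi> =
    \<lparr>carrier = carrier N \<times> carrier Q,
     monoid.mult = (\<lambda>(x, p) (y, q). (x \<otimes>\<^bsub>N\<^esub> \<phi> p y, p \<otimes>\<^bsub>Q\<^esub> q)),
     one = (\<one>\<^bsub>N\<^esub>, \<one>\<^bsub>Q\<^esub>)\<rparr>"

text \<open>
  In the wreath product of \<open>H\<close> and the infinite cyclic group generated by \<open>t\<close>, the pair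
  \<open>(f, m)\<close> stands for the element \<open>x t\<^sup>m\<close>, where \<open>x\<close> is the (finite) product of the elements
  \<open>t\<^sup>-\<^sup>i (f i) t\<^sup>i\<close> over all integers \<open>i\<close>; hence \<open>t\<^sup>m\<close> acts on the base group
  by \<open>f \<mapsto> t\<^sup>m f t\<^sup>-\<^sup>m\<close>, which is the shift \<open>i \<mapsto> f (i + m)\<close>.
\<close>

definition wreath_base :: "('a, 'c) monoid_scheme \<Rightarrow> (int \<Rightarrow> 'a) monoid"
  where "wreath_base H = sum_group UNIV (\<lambda>_. H)"

definition wreath_Z :: "('a, 'c) monoid_scheme \<Rightarrow> ((int \<Rightarrow> 'a) \<times> int) monoid"
  where "wreath_Z H = semidirect_product (wreath_base H) integer_group (\<lambda>m f i. f (i + m))"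

definition finite_generating_set :: "('a, 'c) monoid_scheme \<Rightarrow> 'a set \<Rightarrow> bool"
  where "finite_generating_set G S \<longleftrightarrow> finite S \<and> S \<subseteq> carrier G \<and> generate G S = carrier G"

definition finitely_generated :: "('a, 'c) monoid_scheme \<Rightarrow> bool"
  where "finitely_generated G \<longleftrightarrow> (\<exists>S. finite_generating_set G S)"

text \<open>Meaningful only for elements of the subgroup generated by \<open>S\<close>.\<close>

definition word_length :: "('a, 'c) monoid_scheme \<Rightarrow> 'a set \<Rightarrow> 'a \<Rightarrow> nat"
  where "word_length G S g =
    (LEAST n. \<exists>ws. length ws = n \<and> set ws \<subseteq> S \<union> m_inv G ` S \<and>
                   foldr (\<otimes>\<^bsub>G\<^esub>) ws \<one>\<^bsub>G\<^esub> = g)"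

definition word_ball :: "('a, 'c) monoid_scheme \<Rightarrow> 'a set \<Rightarrow> nat \<Rightarrow> 'a set"
  where "word_ball G S n = {g \<in> carrier G. word_length G S g \<le> n}"

definition degree_of_commutativity :: "('a, 'c) monoid_scheme \<Rightarrow> 'a set \<Rightarrow> ereal"
  where "degree_of_commutativity G S =
    limsup (\<lambda>n. ereal
      (real (card {(g, h) \<in> word_ball G S n \<times> word_ball G S n. g \<otimes>\<^bsub>G\<^esub> h = h \<otimes>\<^bsub>G\<^esub> g}) /
       real (card (word_ball G S n)) ^ 2))"

lemma carrier_wreath_base:
  assumes "group H"
  shows "carrier (wreath_base H) = {f. (\<forall>i. f i \<in> carrier H) \<and> finite {i. f i \<noteq> \<one>\<^bsub>H\<^esub>}}"
  using assms by (auto simp: wreath_base_def carrier_sum_group)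

lemma mult_wreath_base: "f \<otimes>\<^bsub>wreath_base H\<^esub> g = (\<lambda>i. f i \<otimes>\<^bsub>H\<^esub> g i)"
  by (simp add: wreath_base_def restrict_def)

lemma one_wreath_base: "\<one>\<^bsub>wreath_base H\<^esub> = (\<lambda>_. \<one>\<^bsub>H\<^esub>)"
  by (simp add: wreath_base_def restrict_def)

lemma carrier_wreath_Z: "carrier (wreath_Z H) = carrier (wreath_base H) \<times> UNIV"
  by (simp add: wreath_Z_def semidirect_product_def)

lemma mult_wreath_Z:
  "(f, m) \<otimes>\<^bsub>wreath_Z H\<^esub> (g, n) = (\<lambda>i. f i \<otimes>\<^bsub>H\<^esub> g (i + m), m + n)"
  by (simp add: wreath_Z_def semidirect_product_def mult_wreath_base)

lemma one_wreath_Z: "\<one>\<^bsub>wreath_Z H\<^esub> = (\<lambda>_. \<one>\<^bsub>H\<^esub>, 0)"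
  by (simp add: wreath_Z_def semidirect_product_def one_wreath_base)

lemma shift_in_wreath_base:
  assumes "group H" "f \<in> carrier (wreath_base H)"
  shows "(\<lambda>i. f (i + m)) \<in> carrier (wreath_base H)"
proof -
  have "{i. f (i + m) \<noteq> \<one>\<^bsub>H\<^esub>} \<subseteq> (\<lambda>i. i - m) ` {i. f i \<noteq> \<one>\<^bsub>H\<^esub>}"
    by (auto intro!: image_eqI[where x = "_ + m"])
  with assms show ?thesis
    by (auto simp: carrier_wreath_base intro: finite_subset)
qed

lemma group_wreath_Z:
  assumes "group H"
  shows "group (wreath_Z H)"
proof -
  interpret H: group H by fact
  interpret B: group "wreath_base H"
    unfolding wreath_base_def by (simp add: assms)
  have mem: "f i \<in> carrier H" if "f \<in> carrier (wreath_base H)" for f i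
    using that assms by (simp add: carrier_wreath_base)
  have closed: "x \<otimes>\<^bsub>wreath_Z H\<^esub> y \<in> carrier (wreath_Z H)"
    if "x \<in> carrier (wreath_Z H)" "y \<in> carrier (wreath_Z H)" for x y
  proof -
    obtain f m g n where xy: "x = (f, m)" "y = (g, n)"
      and f: "f \<in> carrier (wreath_base H)" and g: "g \<in> carrier (wreath_base H)"
      using \<open>x \<in> _\<close> \<open>y \<in> _\<close> by (auto simp: carrier_wreath_Z)
    show ?thesis
      using B.m_closed[OF f shift_in_wreath_base[OF assms g, of m]]
      by (simp add: xy carrier_wreath_Z mult_wreath_Z mult_wreath_base)
  qed
  show ?thesis
  proof (rule groupI)
    fix x assume "x \<in> carrier (wreath_Z H)"
    then obtain f m where x: "x = (f, m)" and f: "f \<in> carrier (wreath_base H)"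
      by (auto simp: carrier_wreath_Z)
    define g where "g = inv\<^bsub>wreath_base H\<^esub> f"
    have g: "g \<in> carrier (wreath_base H)"
      using f by (simp add: g_def)
    have "g \<otimes>\<^bsub>wreath_base H\<^esub> f = \<one>\<^bsub>wreath_base H\<^esub>"
      using f by (simp add: g_def)
    then have "g i \<otimes>\<^bsub>H\<^esub> f i = \<one>\<^bsub>H\<^esub>" for i
      by (simp add: mult_wreath_base one_wreath_base fun_eq_iff)
    then have "(\<lambda>i. g (i - m), - m) \<otimes>\<^bsub>wreath_Z H\<^esub> x = \<one>\<^bsub>wreath_Z H\<^esub>"
      by (simp add: x mult_wreath_Z one_wreath_Z)
    moreover have "(\<lambda>i. g (i - m), - m) \<in> carrier (wreath_Z H)"
      using shift_in_wreath_base[OF assms g, of "- m"] by (simp add: carrier_wreath_Z)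
    ultimately show "\<exists>y\<in>carrier (wreath_Z H). y \<otimes>\<^bsub>wreath_Z H\<^esub> x = \<one>\<^bsub>wreath_Z H\<^esub>"
      by blast
  next
    show "\<one>\<^bsub>wreath_Z H\<^esub> \<in> carrier (wreath_Z H)"
      using B.one_closed by (simp add: carrier_wreath_Z one_wreath_Z one_wreath_base)
  next
    fix x y assume "x \<in> carrier (wreath_Z H)" "y \<in> carrier (wreath_Z H)"
    then show "x \<otimes>\<^bsub>wreath_Z H\<^esub> y \<in> carrier (wreath_Z H)"
      by (rule closed)
  qed (auto simp: carrier_wreath_Z mult_wreath_Z one_wreath_Z mem H.m_assoc add_ac)
qed

text \<open>The copy of \<open>H\<close> in coordinate \<open>i\<close> is the conjugate of the one in coordinate 0 by \<open>t\<^sup>i\<close>.\<close>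

lemma wreath_Z_conjugate:
  assumes "group H" "h \<in> carrier H"
  shows "(\<lambda>_. \<one>\<^bsub>H\<^esub>, - i) \<otimes>\<^bsub>wreath_Z H\<^esub> ((\<lambda>_. \<one>\<^bsub>H\<^esub>)(0 := h), 0) \<otimes>\<^bsub>wreath_Z H\<^esub> (\<lambda>_. \<one>\<^bsub>H\<^esub>, i)
       = ((\<lambda>_. \<one>\<^bsub>H\<^esub>)(i := h), 0)"
proof -
  interpret group H by fact
  show ?thesis using assms(2) by (auto simp: mult_wreath_Z fun_eq_iff)
qed

end

(*
  A commuting pair has a member outside the base group N, or both members in N. The centralizer of
  an element outside N meets N trivially, so it contains only linearly many elements of the ball
  B(n), whereas |B(n)| grows at least quadratically. It remains to see that N has density zero.

  The geodesic word of g in N is a closed walk on the integers starting at 0. Call e the difference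
  between its maximal and its minimal position. Cutting the walk at both extremes and reversing some
  of the pieces gives g or its inverse as Z^-1 Y X^-1, where X and Z walk to the right extreme from
  the start and to the start from the left extreme (in their own coordinates), and Y walks from the
  left to the right extreme. With separating shifts T, the product X T Y T Z has bounded excess
  length and determines X, Y, Z up to the e + 1 possible values of the position of Z. On the other
  hand, two additional lamps that cancel in Z^-1 Y X^-1 can be placed in about e^2/8 ways, at bounded
  cost. Hence the elements with e >= E have density O(1/E). If the walk stays within [-E, E], then
  cutting a geodesic word of length at least L at one of its first L + 1 places, and separating the
  two parts by a shift, gives L + 1 elements for each g, with multiplicity at most 2E + 1; so such
  elements have density O(1/L) for fixed E.
*)

theory Submission
  imports Defs
begin

section \<open>Words and balls\<close>

definition word_prod :: "('a, 'c) monoid_scheme \<Rightarrow> 'a list \<Rightarrow> 'a"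
  where "word_prod G ws = foldr (\<otimes>\<^bsub>G\<^esub>) ws \<one>\<^bsub>G\<^esub>"

definition gens :: "('a, 'c) monoid_scheme \<Rightarrow> 'a set \<Rightarrow> 'a set"
  where "gens G S = S \<union> m_inv G ` S"

locale generated_group = group G for G (structure) +
  fixes S
  assumes finite_generating: "finite_generating_set G S"
begin

abbreviation "prd \<equiv> word_prod G"
abbreviation "\<B> \<equiv> word_ball G S"

lemma inv_mult_cancel: "x \<in> carrier G \<Longrightarrow> y \<in> carrier G \<Longrightarrow> inv x \<otimes> (x \<otimes> y) = y"
  by (simp flip: m_assoc)

lemma mult_inv_cancel: "x \<in> carrier G \<Longrightarrow> y \<in> carrier G \<Longrightarrow> x \<otimes> (inv x \<otimes> y) = y"
  by (simp flip: m_assoc)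

lemma gens_carrier: "s \<in> gens G S \<Longrightarrow> s \<in> carrier G"
  using finite_generating by (auto simp: gens_def finite_generating_set_def)

lemma finite_gens: "finite (gens G S)"
  using finite_generating by (auto simp: gens_def finite_generating_set_def)

lemma inv_gens: "s \<in> gens G S \<Longrightarrow> inv s \<in> gens G S"
  using finite_generating by (auto simp: gens_def finite_generating_set_def)

lemma word_prod_Nil [simp]: "prd [] = \<one>"
  by (simp add: word_prod_def)

lemma word_prod_Cons [simp]: "prd (s # ws) = s \<otimes> prd ws"
  by (simp add: word_prod_def)

lemma word_prod_closed [simp]: "set ws \<subseteq> gens G S \<Longrightarrow> prd ws \<in> carrier G"
  by (induction ws) (auto simp: gens_carrier)

lemma word_prod_append:
  "set us \<subseteq> gens G S \<Longrightarrow> set vs \<subseteq> gens G S \<Longrightarrow> prd (us @ vs) = prd us \<otimes> prd vs"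
  by (induction us) (auto simp: gens_carrier m_assoc)

lemma ex_inverse_word:
  "set ws \<subseteq> gens G S \<Longrightarrow>
    \<exists>us. set us \<subseteq> gens G S \<and> length us = length ws \<and> prd us = inv (prd ws)"
proof (induction ws)
  case (Cons s ws)
  then obtain us where us: "set us \<subseteq> gens G S" "length us = length ws" "prd us = inv (prd ws)"
    by auto
  have "prd (us @ [inv s]) = inv (prd (s # ws))"
    using us Cons.prems by (subst word_prod_append) (auto simp: inv_gens gens_carrier inv_mult_group)
  then show ?case
    using us Cons.prems by (intro exI[of _ "us @ [inv s]"]) (auto simp: inv_gens)
qed auto

lemma ex_word:
  assumes "g \<in> carrier G"
  shows "\<exists>ws. set ws \<subseteq> gens G S \<and> prd ws = g"
proof -
  have "g \<in> generate G S"
    using assms finite_generating by (simp add: finite_generating_set_def)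
  then show ?thesis
  proof induction
    case one
    show ?case by (intro exI[of _ "[]"]) simp
  next
    case (incl h)
    then have "h \<in> gens G S" by (simp add: gens_def)
    then show ?case by (intro exI[of _ "[h]"]) (simp add: gens_carrier)
  next
    case (inv h)
    then have "inv h \<in> gens G S" by (simp add: gens_def)
    then show ?case by (intro exI[of _ "[inv h]"]) (simp add: gens_carrier)
  next
    case (eng h1 h2)
    then show ?case by (metis word_prod_append set_append Un_least)
  qed
qed

lemma word_length_le:
  assumes "set ws \<subseteq> gens G S"
  shows "word_length G S (prd ws) \<le> length ws"
  unfolding word_length_def using assms
  by (intro Least_le exI[of _ ws]) (auto simp: word_prod_def gens_def)

lemma ex_geodesic:
  assumes "g \<in> carrier G"
  shows "\<exists>ws. set ws \<subseteq> gens G S \<and> prd ws = g \<and> length ws = word_length G S g"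
proof -
  have "\<exists>n ws. length ws = n \<and> set ws \<subseteq> S \<union> m_inv G ` S \<and> foldr (\<otimes>) ws \<one> = g"
    using ex_word[OF assms] by (auto simp: word_prod_def gens_def)
  then have "\<exists>ws. length ws = word_length G S g \<and> set ws \<subseteq> S \<union> m_inv G ` S \<and> foldr (\<otimes>) ws \<one> = g"
    unfolding word_length_def by (rule LeastI_ex)
  then show ?thesis by (auto simp: word_prod_def gens_def)
qed

lemma mem_ball_iff:
  "g \<in> \<B> n \<longleftrightarrow> (\<exists>ws. set ws \<subseteq> gens G S \<and> prd ws = g \<and> length ws \<le> n)"
proof
  assume "g \<in> \<B> n"
  then show "\<exists>ws. set ws \<subseteq> gens G S \<and> prd ws = g \<and> length ws \<le> n"
    using ex_geodesic[of g] by (auto simp: word_ball_def)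
next
  assume "\<exists>ws. set ws \<subseteq> gens G S \<and> prd ws = g \<and> length ws \<le> n"
  then show "g \<in> \<B> n"
    using word_length_le by (fastforce simp: word_ball_def)
qed

lemma ball_carrier: "g \<in> \<B> n \<Longrightarrow> g \<in> carrier G"
  by (simp add: word_ball_def)

lemma ball_mono: "g \<in> \<B> m \<Longrightarrow> m \<le> n \<Longrightarrow> g \<in> \<B> n"
  by (simp add: word_ball_def)

lemma one_ball: "\<one> \<in> \<B> n"
  by (auto simp: mem_ball_iff intro: exI[of _ "[]"])

lemma word_prod_ball: "set ws \<subseteq> gens G S \<Longrightarrow> prd ws \<in> \<B> (length ws)"
  by (auto simp: mem_ball_iff)

lemma mult_ball:
  assumes "x \<in> \<B> m" "y \<in> \<B> n"
  shows "x \<otimes> y \<in> \<B> (m + n)"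
proof -
  obtain us vs where "set us \<subseteq> gens G S" "prd us = x" "length us \<le> m"
    "set vs \<subseteq> gens G S" "prd vs = y" "length vs \<le> n"
    using assms by (auto simp: mem_ball_iff)
  then show ?thesis
    unfolding mem_ball_iff by (intro exI[of _ "us @ vs"]) (auto simp: word_prod_append)
qed

lemma inv_ball: "x \<in> \<B> n \<Longrightarrow> inv x \<in> \<B> n"
  unfolding mem_ball_iff using ex_inverse_word by metis

lemma ball_split:
  assumes "g \<in> \<B> (m + n)"
  shows "\<exists>x y. x \<in> \<B> m \<and> y \<in> \<B> n \<and> g = x \<otimes> y"
proof -
  obtain ws where ws: "set ws \<subseteq> gens G S" "prd ws = g" "length ws \<le> m + n"
    using assms by (auto simp: mem_ball_iff)
  have sub: "set (take m ws) \<subseteq> gens G S" "set (drop m ws) \<subseteq> gens G S"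
    using ws(1) set_take_subset set_drop_subset by fast+
  have "g = prd (take m ws) \<otimes> prd (drop m ws)"
    using word_prod_append[OF sub] ws(2) by simp
  moreover have "prd (take m ws) \<in> \<B> m" "prd (drop m ws) \<in> \<B> n"
    using word_prod_ball[OF sub(1)] word_prod_ball[OF sub(2)] ws(3)
    by (auto intro: ball_mono)
  ultimately show ?thesis by blast
qed

lemma finite_ball: "finite (\<B> n)"
proof -
  have "\<B> n \<subseteq> prd ` {ws. set ws \<subseteq> gens G S \<and> length ws \<le> n}"
    by (auto simp: mem_ball_iff)
  then show ?thesis
    by (rule finite_subset) (simp add: finite_lists_length_le finite_gens)
qed

lemma card_ball_pos: "card (\<B> n) > 0"
  using one_ball finite_ball card_gt_0_iff by blast

text \<open>Cutting a word after \<open>m\<close> letters writes every element as a product. This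
  submultiplicativity later turns each bounded excess of radius into a constant factor.\<close>

lemma card_ball_add: "card (\<B> (m + n)) \<le> card (\<B> m) * card (\<B> n)"
proof -
  have "\<B> (m + n) \<subseteq> (\<lambda>(x, y). x \<otimes> y) ` (\<B> m \<times> \<B> n)"
    using ball_split by fastforce
  then have "card (\<B> (m + n)) \<le> card (\<B> m \<times> \<B> n)"
    by (intro surj_card_le) (auto simp: finite_ball)
  then show ?thesis by (simp add: card_cartesian_product)
qed

lemma ex_ball: "g \<in> carrier G \<Longrightarrow> \<exists>n. g \<in> \<B> n"
  by (auto simp: word_ball_def)

lemma finite_subset_ball:
  assumes "finite A" "A \<subseteq> carrier G"
  shows "\<exists>n. A \<subseteq> \<B> n"
  using assms
proof induction
  case (insert x A)
  then obtain m n where "A \<subseteq> \<B> m" "x \<in> \<B> n"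
    using ex_ball[of x] by blast
  then have "insert x A \<subseteq> \<B> (max m n)"
    using ball_mono by fastforce
  then show ?case ..
qed auto

text \<open>One word is fixed for each \<open>g\<close>, so that its prefixes and the walk they
  describe are functions of \<open>g\<close>.\<close>

definition geodesic :: "'a \<Rightarrow> 'a list"
  where "geodesic g = (SOME ws. set ws \<subseteq> gens G S \<and> prd ws = g \<and> length ws = word_length G S g)"

lemma geodesic:
  assumes "g \<in> carrier G"
  shows "set (geodesic g) \<subseteq> gens G S" "prd (geodesic g) = g"
    "length (geodesic g) = word_length G S g"
  using someI_ex[OF ex_geodesic[OF assms]] unfolding geodesic_def by blast+

section \<open>Prefixes and segments of words\<close>

lemma set_take_gens: "set ws \<subseteq> gens G S \<Longrightarrow> set (take j ws) \<subseteq> gens G S"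
  using set_take_subset by fast

lemma set_drop_gens: "set ws \<subseteq> gens G S \<Longrightarrow> set (drop j ws) \<subseteq> gens G S"
  using set_drop_subset by fast

lemma word_prod_take_drop:
  assumes "set ws \<subseteq> gens G S"
  shows "prd ws = prd (take j ws) \<otimes> prd (drop j ws)"
  using word_prod_append[OF set_take_gens[OF assms] set_drop_gens[OF assms], of j j] by simp

lemma word_segment_ball:
  assumes "set ws \<subseteq> gens G S" "j \<le> k" "k \<le> length ws"
  shows "inv (prd (take j ws)) \<otimes> prd (take k ws) \<in> \<B> (k - j)"
proof -
  have "prd (take k ws) = prd (take j ws) \<otimes> prd (drop j (take k ws))"
    using word_prod_take_drop[OF set_take_gens[OF assms(1)], of k j] assms(2) by (simp add: min_def)
  then have "inv (prd (take j ws)) \<otimes> prd (take k ws) = prd (drop j (take k ws))"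
    by (simp add: assms(1) set_take_gens set_drop_gens inv_solve_left')
  then show ?thesis
    using word_prod_ball[OF set_drop_gens[OF set_take_gens[OF assms(1)]], of j k] assms(2,3)
    by (simp add: min.absorb2)
qed

text \<open>If two prefixes had the same product, deleting the letters between them would give a
  shorter word for \<open>g\<close>.\<close>

lemma geodesic_prefix_inj:
  assumes g: "g \<in> carrier G"
    and le: "j \<le> word_length G S g" "k \<le> word_length G S g"
    and eq: "prd (take j (geodesic g)) = prd (take k (geodesic g))"
  shows "j = k"
proof -
  have less: False if "j < k" "k \<le> word_length G S g"
    "prd (take j (geodesic g)) = prd (take k (geodesic g))" for j k
  proof -
    let ?ws = "take j (geodesic g) @ drop k (geodesic g)"
    have sub: "set ?ws \<subseteq> gens G S"
      using geodesic(1)[OF g] set_take_gens set_drop_gens by auto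
    have "prd ?ws = prd (take k (geodesic g)) \<otimes> prd (drop k (geodesic g))"
      using that(3) geodesic(1)[OF g] by (simp add: word_prod_append set_take_gens set_drop_gens)
    also have "\<dots> = g"
      using word_prod_take_drop[OF geodesic(1)[OF g], of k] geodesic(2)[OF g] by simp
    finally have "word_length G S g \<le> length ?ws"
      using word_length_le[OF sub] by simp
    then show False using that(1,2) geodesic(3)[OF g] by simp
  qed
  show ?thesis
    using less[of j k] less[of k j] le eq by (metis nat_neq_iff)
qed

end

section \<open>Positions and lamps\<close>

text \<open>The sign: in \<open>(f, m) \<otimes> (g, n)\<close> the lamp of \<open>g\<close> at \<open>j\<close> ends up at \<open>j - m\<close>.\<close>

definition pos :: "(int \<Rightarrow> 'a) \<times> int \<Rightarrow> int"
  where "pos x = - snd x"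

definition lamps :: "('a, 'b) monoid_scheme \<Rightarrow> int set \<Rightarrow> 'a \<Rightarrow> (int \<Rightarrow> 'a) \<times> int"
  where "lamps H A h = (\<lambda>i. if i \<in> A then h else \<one>\<^bsub>H\<^esub>, 0)"

definition shift :: "('a, 'b) monoid_scheme \<Rightarrow> int \<Rightarrow> (int \<Rightarrow> 'a) \<times> int"
  where "shift H m = (\<lambda>_. \<one>\<^bsub>H\<^esub>, - m)"

lemma pos_lamps [simp]: "pos (lamps H A h) = 0"
  by (simp add: pos_def lamps_def)

lemma fst_lamps [simp]: "fst (lamps H A h) i = (if i \<in> A then h else \<one>\<^bsub>H\<^esub>)"
  by (simp add: lamps_def)

lemma pos_shift [simp]: "pos (shift H m) = m"
  by (simp add: pos_def shift_def)

lemma fst_shift [simp]: "fst (shift H m) i = \<one>\<^bsub>H\<^esub>"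
  by (simp add: shift_def)

section \<open>The group operations in coordinates\<close>

locale wreath_generated = generated_group G S
  for G :: "((int \<Rightarrow> 'a) \<times> int) monoid" (structure) and S +
  fixes H :: "('a, 'b) monoid_scheme"
  assumes group_H: "group H" and G_eq: "G = wreath_Z H"
begin

sublocale H: group H by (rule group_H)

lemma mem_G_iff:
  "x \<in> carrier G \<longleftrightarrow> (\<forall>i. fst x i \<in> carrier H) \<and> finite {i. fst x i \<noteq> \<one>\<^bsub>H\<^esub>}"
  by (cases x) (simp add: G_eq carrier_wreath_Z carrier_wreath_base group_H)

lemma fst_closed [simp]: "x \<in> carrier G \<Longrightarrow> fst x i \<in> carrier H"
  by (simp add: mem_G_iff)

lemma pos_mult [simp]: "pos (x \<otimes> y) = pos x + pos y"
  by (cases x; cases y) (simp add: G_eq mult_wreath_Z pos_def)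

lemma fst_mult: "fst (x \<otimes> y) i = fst x i \<otimes>\<^bsub>H\<^esub> fst y (i - pos x)"
  by (cases x; cases y) (simp add: G_eq mult_wreath_Z pos_def)

lemma pos_one [simp]: "pos \<one> = 0"
  by (simp add: G_eq one_wreath_Z pos_def)

lemma fst_one [simp]: "fst \<one> i = \<one>\<^bsub>H\<^esub>"
  by (simp add: G_eq one_wreath_Z)

lemma wreath_eqI:
  fixes x y :: "(int \<Rightarrow> 'a) \<times> int"
  shows "(\<And>i. fst x i = fst y i) \<Longrightarrow> pos x = pos y \<Longrightarrow> x = y"
  by (cases x; cases y) (auto simp: pos_def)

lemma pos_inv [simp]: "x \<in> carrier G \<Longrightarrow> pos (inv x) = - pos x"
  using pos_mult[of "inv x" x] by simp

lemma fst_inv: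
  assumes "x \<in> carrier G"
  shows "fst (inv x) i = inv\<^bsub>H\<^esub> (fst x (i + pos x))"
proof -
  have "fst (inv x) i \<otimes>\<^bsub>H\<^esub> fst x (i + pos x) = \<one>\<^bsub>H\<^esub>"
    using assms fst_mult[of "inv x" x i] by simp
  then show ?thesis
    using assms by (intro H.inv_equality[symmetric]) simp_all
qed

lemma lamps_closed [simp]:
  "finite A \<Longrightarrow> h \<in> carrier H \<Longrightarrow> lamps H A h \<in> carrier G"
  by (auto simp: mem_G_iff intro: finite_subset[of _ A])

lemma shift_closed [simp]: "shift H m \<in> carrier G"
  by (simp add: mem_G_iff)

lemma lamps_insert:
  "i \<notin> A \<Longrightarrow> h \<in> carrier H \<Longrightarrow> lamps H (insert i A) h = lamps H {i} h \<otimes> lamps H A h"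
  by (rule wreath_eqI) (auto simp: fst_mult)

lemma shift_add: "shift H (m + n) = shift H m \<otimes> shift H n"
  by (rule wreath_eqI) (auto simp: fst_mult)

text \<open>The shift moves the lamps of \<open>Y\<close> beyond \<open>r\<close>, so up to
  \<open>r\<close> the product shows the lamps of \<open>X\<close> alone. Where the shifted lamps
  begin depends on \<open>pos X\<close>, hence the assumption of equal positions; in the counting
  arguments this position is recorded separately.\<close>

lemma separated_product_cancel:
  assumes G: "X \<in> carrier G" "X' \<in> carrier G" "Y \<in> carrier G" "Y' \<in> carrier G"
    and pos: "pos X = pos X'"
    and X: "\<And>i. r < i \<Longrightarrow> fst X i = \<one>\<^bsub>H\<^esub>" "\<And>i. r < i \<Longrightarrow> fst X' i = \<one>\<^bsub>H\<^esub>"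
    and Y: "\<And>i. i < r' \<Longrightarrow> fst Y i = \<one>\<^bsub>H\<^esub>" "\<And>i. i < r' \<Longrightarrow> fst Y' i = \<one>\<^bsub>H\<^esub>"
    and sep: "r < pos X + M + r'"
    and eq: "X \<otimes> shift H M \<otimes> Y = X' \<otimes> shift H M \<otimes> Y'"
  shows "X = X' \<and> Y = Y'"
proof
  show XX': "X = X'"
  proof (rule wreath_eqI)
    fix i
    show "fst X i = fst X' i"
    proof (cases "i \<le> r")
      case True
      have "fst (X \<otimes> shift H M \<otimes> Y) i = fst (X' \<otimes> shift H M \<otimes> Y') i"
        by (simp add: eq)
      then show ?thesis
        using True sep pos G by (simp add: fst_mult Y)
    qed (simp add: X)
  qed (rule pos)
  show "Y = Y'"
    using eq G unfolding XX' by simp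
qed

end

text \<open>\<open>c\<close> bounds both the displacement and the reach of a single generator;
  \<open>C\<close> is the price of one lamp \<open>h\<close> within that reach. Both are fixed
  before any radius is considered.\<close>

locale wreath_bounded = wreath_generated G S H
  for G :: "((int \<Rightarrow> 'a) \<times> int) monoid" (structure) and S and H :: "('a, 'b) monoid_scheme" +
  fixes c :: int and C :: nat and h :: 'a
  assumes c_nonneg: "0 \<le> c"
    and h_closed [simp]: "h \<in> carrier H" and h_neq_one: "h \<noteq> \<one>\<^bsub>H\<^esub>"
    and pos_gens: "s \<in> gens G S \<Longrightarrow> \<bar>pos s\<bar> \<le> c"
    and supp_gens: "s \<in> gens G S \<Longrightarrow> c < \<bar>i\<bar> \<Longrightarrow> fst s i = \<one>\<^bsub>H\<^esub>"
    and lamp_ball: "\<bar>i\<bar> \<le> c \<Longrightarrow> lamps H {i} h \<in> \<B> C"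
begin

lemma lamps_inject:
  assumes "lamps H A h = lamps H A' h"
  shows "A = A'"
proof -
  have "fst (lamps H A h) i = fst (lamps H A' h) i" for i
    using assms by simp
  then have "i \<in> A \<longleftrightarrow> i \<in> A'" for i
    using h_neq_one by (metis fst_lamps)
  then show ?thesis by blast
qed

lemma pos_word:
  "set ws \<subseteq> gens G S \<Longrightarrow> \<bar>pos (prd ws)\<bar> \<le> c * int (length ws)"
proof (induction ws)
  case (Cons s ws)
  then have "\<bar>pos s\<bar> \<le> c" "\<bar>pos (prd ws)\<bar> \<le> c * int (length ws)"
    by (auto intro: pos_gens)
  then show ?case by (simp add: algebra_simps)
qed simp

lemma pos_ball:
  assumes "x \<in> \<B> n"
  shows "\<bar>pos x\<bar> \<le> c * int n"
proof -
  obtain ws where ws: "set ws \<subseteq> gens G S" "prd ws = x" "length ws \<le> n"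
    using assms by (auto simp: mem_ball_iff)
  have "\<bar>pos x\<bar> \<le> c * int (length ws)"
    using pos_word ws by auto
  also have "\<dots> \<le> c * int n"
    using ws(3) c_nonneg by (simp add: mult_left_mono)
  finally show ?thesis .
qed

text \<open>Cut the word at the first moment its position comes within \<open>c\<close> of \<open>i\<close>: until then
  the coordinate \<open>i\<close> has not been touched.\<close>

lemma word_split_near:
  assumes "set ws \<subseteq> gens G S"
    and "0 \<le> i \<and> i \<le> pos (prd ws) \<or> pos (prd ws) \<le> i \<and> i \<le> 0"
  shows "\<exists>us vs. set us \<subseteq> gens G S \<and> set vs \<subseteq> gens G S \<and> ws = us @ vs \<and>
    \<bar>i - pos (prd us)\<bar> \<le> c \<and> fst (prd us) i = \<one>\<^bsub>H\<^esub>"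
  using assms
proof (induction ws arbitrary: i)
  case Nil
  then show ?case using c_nonneg by (intro exI[of _ "[]"]) auto
next
  case (Cons s ws)
  show ?case
  proof (cases "\<bar>i\<bar> \<le> c")
    case True
    then show ?thesis using Cons.prems
      by (intro exI[of _ "[]"] exI[of _ "s # ws"]) auto
  next
    case False
    have s: "s \<in> gens G S" "\<bar>pos s\<bar> \<le> c" "fst s i = \<one>\<^bsub>H\<^esub>"
      using Cons.prems False by (auto intro: pos_gens supp_gens)
    \<comment> \<open>A letter moves by at most \<open>c\<close>, so it cannot jump over
      \<open>i\<close>, which is further away than that.\<close>
    have "0 \<le> i - pos s \<and> i - pos s \<le> pos (prd ws) \<or> pos (prd ws) \<le> i - pos s \<and> i - pos s \<le> 0"
      using Cons.prems(2) s(2) False by auto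
    then obtain us vs where "set us \<subseteq> gens G S" "set vs \<subseteq> gens G S" "ws = us @ vs"
      "\<bar>i - pos s - pos (prd us)\<bar> \<le> c" "fst (prd us) (i - pos s) = \<one>\<^bsub>H\<^esub>"
      using Cons.IH[of "i - pos s"] Cons.prems(1) by auto
    then show ?thesis
      using s by (intro exI[of _ "s # us"] exI[of _ vs]) (auto simp: fst_mult algebra_simps)
  qed
qed

text \<open>The walk of \<open>v\<close> passes within \<open>c\<close> of \<open>i\<close>, and the
  lamp is inserted at that moment for the price \<open>C\<close>.\<close>

lemma lamp_mult_ball:
  assumes "v \<in> \<B> n" and i: "0 \<le> i \<and> i \<le> pos v \<or> pos v \<le> i \<and> i \<le> 0"
  shows "lamps H {i} h \<otimes> v \<in> \<B> (n + C)"
proof -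
  obtain ws where ws: "set ws \<subseteq> gens G S" "prd ws = v" "length ws \<le> n"
    using assms by (auto simp: mem_ball_iff)
  obtain us vs where uv: "set us \<subseteq> gens G S" "set vs \<subseteq> gens G S" "ws = us @ vs"
    "\<bar>i - pos (prd us)\<bar> \<le> c" "fst (prd us) i = \<one>\<^bsub>H\<^esub>"
    using word_split_near[OF ws(1), of i] i ws(2) by auto
  have closed: "prd us \<in> carrier G" "prd vs \<in> carrier G"
    using uv by auto
  \<comment> \<open>Even for non-abelian \<open>H\<close> the lamp passes the prefix, since the
    prefix is trivial in coordinate \<open>i\<close>.\<close>
  have "lamps H {i} h \<otimes> prd us = prd us \<otimes> lamps H {i - pos (prd us)} h"
    using uv(1,5) by (intro wreath_eqI) (auto simp: fst_mult)
  moreover have "v = prd us \<otimes> prd vs"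
    using ws(2) uv(1,2,3) by (simp add: word_prod_append)
  ultimately have "lamps H {i} h \<otimes> v = prd us \<otimes> lamps H {i - pos (prd us)} h \<otimes> prd vs"
    using m_assoc[of "lamps H {i} h" "prd us" "prd vs"] closed by simp
  also have "\<dots> \<in> \<B> (length us + C + length vs)"
    using uv by (intro mult_ball word_prod_ball lamp_ball)
  finally show ?thesis
    using uv(3) ws(3) by (auto intro: ball_mono)
qed

lemma lamps_mult_ball:
  assumes "finite A" "v \<in> \<B> n"
    and "\<And>i. i \<in> A \<Longrightarrow> 0 \<le> i \<and> i \<le> pos v \<or> pos v \<le> i \<and> i \<le> 0"
  shows "lamps H A h \<otimes> v \<in> \<B> (n + card A * C)"
  using assms(1,3)
proof (induction A)
  case empty
  have "lamps H {} h = \<one>"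
    by (rule wreath_eqI) auto
  then show ?case using assms(2) ball_carrier by simp
next
  case (insert i A)
  have v: "v \<in> carrier G"
    using assms(2) ball_carrier by blast
  have "lamps H {i} h \<otimes> (lamps H A h \<otimes> v) \<in> \<B> (n + card A * C + C)"
    using insert by (intro lamp_mult_ball) auto
  moreover have "lamps H (insert i A) h \<otimes> v = lamps H {i} h \<otimes> (lamps H A h \<otimes> v)"
    using insert v by (subst lamps_insert) (simp_all add: m_assoc)
  ultimately show ?case
    using insert by (simp add: algebra_simps)
qed

text \<open>A letter touches only coordinates within \<open>c\<close> of the position at which it is
  read.\<close>

lemma supp_prefixes:
  assumes ws: "set ws \<subseteq> gens G S"
    and bd: "\<And>j. j \<le> length ws \<Longrightarrow> lo \<le> pos (prd (take j ws)) \<and> pos (prd (take j ws)) \<le> hi"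
    and j: "j \<le> length ws" and i: "i < lo - c \<or> hi + c < i"
  shows "fst (prd (take j ws)) i = \<one>\<^bsub>H\<^esub>"
  using j
proof (induction j)
  case (Suc j)
  have s: "ws ! j \<in> gens G S"
    using ws Suc.prems by auto
  have "prd (take (Suc j) ws) = prd (take j ws) \<otimes> ws ! j"
    using Suc.prems s ws by (simp add: take_Suc_conv_app_nth word_prod_append set_take_gens gens_carrier)
  moreover have "c < \<bar>i - pos (prd (take j ws))\<bar>"
    using bd[of j] Suc.prems i by auto
  ultimately show ?case
    using Suc supp_gens[OF s] by (simp add: fst_mult)
qed simp

section \<open>Base elements with a wide walk\<close>

text \<open>\<open>a\<close> and \<open>b\<close> are the distances from the start of the walk to
  its left and right extremes. The origin is the start for \<open>X\<close> and the left extreme for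
  \<open>Y\<close> and \<open>Z\<close>. In the product to be formed \<open>X\<close> stands first
  and is bounded on the right, \<open>Z\<close> stands last and is bounded on the left, and
  \<open>Y\<close> in the middle is bounded on both sides.\<close>

definition triples where
  "triples a b n = {(X, Y, Z). pos X = b \<and> pos Y = a + b \<and> pos Z = a \<and>
    (\<forall>i. b + c < i \<longrightarrow> fst X i = \<one>\<^bsub>H\<^esub>) \<and>
    (\<forall>i. i < - c \<or> a + b + c < i \<longrightarrow> fst Y i = \<one>\<^bsub>H\<^esub>) \<and>
    (\<forall>i. i < - c \<longrightarrow> fst Z i = \<one>\<^bsub>H\<^esub>) \<and>
    (\<exists>lx ly lz. X \<in> \<B> lx \<and> Y \<in> \<B> ly \<and> Z \<in> \<B> lz \<and> lx + ly + lz \<le> n)}"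

lemma triples_closed:
  "(X, Y, Z) \<in> triples a b n \<Longrightarrow> X \<in> carrier G \<and> Y \<in> carrier G \<and> Z \<in> carrier G"
  by (auto simp: triples_def dest: ball_carrier)

lemma finite_triples: "finite (triples a b n)"
proof (rule finite_subset)
  show "triples a b n \<subseteq> \<B> n \<times> \<B> n \<times> \<B> n"
    by (auto simp: triples_def intro: ball_mono)
qed (simp add: finite_ball)

text \<open>The separating shifts make \<open>X\<close>, \<open>Y\<close>, \<open>Z\<close> readable
  from the product, as their positions are prescribed by \<open>a\<close> and \<open>b\<close>. The
  position of the product depends on \<open>a + b\<close> only, so products for different widths are
  different.\<close>

lemma card_triples:
  assumes ab: "0 \<le> a" "0 \<le> b" and t: "shift H (2 * c + 1) \<in> \<B> t"
  shows "card (triples a b n) \<le> card {x \<in> \<B> (n + 2 * t). pos x = 2 * (a + b) + 2 * (2 * c + 1)}"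
proof (rule card_inj_on_le)
  let ?T = "shift H (2 * c + 1)"
  let ?f = "\<lambda>(X, Y, Z). X \<otimes> ?T \<otimes> (Y \<otimes> ?T \<otimes> Z)"
  show "inj_on ?f (triples a b n)"
  proof (rule inj_onI)
    fix x y
    assume xy: "x \<in> triples a b n" "y \<in> triples a b n" "?f x = ?f y"
    obtain X Y Z X' Y' Z' where x: "x = (X, Y, Z)" and y: "y = (X', Y', Z')"
      by (metis prod_cases3)
    have m: "(X, Y, Z) \<in> triples a b n" "(X', Y', Z') \<in> triples a b n"
      and eq: "X \<otimes> ?T \<otimes> (Y \<otimes> ?T \<otimes> Z) = X' \<otimes> ?T \<otimes> (Y' \<otimes> ?T \<otimes> Z')"
      using xy by (simp_all add: x y)
    note cl = triples_closed[OF m(1)] triples_closed[OF m(2)]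
    have W: "fst (Y \<otimes> ?T \<otimes> Z) i = \<one>\<^bsub>H\<^esub>" if "(X, Y, Z) \<in> triples a b n" "i < - c" for X Y Z i
      using that ab c_nonneg by (auto simp: triples_def fst_mult)
    \<comment> \<open>The separation condition reads \<open>b + c < b + (2 * c + 1) - c\<close>, so
      \<open>2 * c + 1\<close> is the least gap that works.\<close>
    have XX: "X = X' \<and> Y \<otimes> ?T \<otimes> Z = Y' \<otimes> ?T \<otimes> Z'"
      using m cl c_nonneg
      by (intro separated_product_cancel[where r = "b + c" and r' = "- c" and M = "2 * c + 1"]
            eq W[OF m(1)] W[OF m(2)])
        (auto simp: triples_def)
    moreover have "Y = Y' \<and> Z = Z'"
      using m cl c_nonneg XX
      by (intro separated_product_cancel[where r = "a + b + c" and r' = "- c" and M = "2 * c + 1"])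
        (auto simp: triples_def)
    ultimately show "x = y" by (simp add: x y)
  qed
  show "?f ` triples a b n \<subseteq> {x \<in> \<B> (n + 2 * t). pos x = 2 * (a + b) + 2 * (2 * c + 1)}"
  proof (rule image_subsetI)
    fix x
    assume "x \<in> triples a b n"
    moreover obtain X Y Z where x: "x = (X, Y, Z)"
      by (metis prod_cases3)
    ultimately obtain lx ly lz where l: "X \<in> \<B> lx" "Y \<in> \<B> ly" "Z \<in> \<B> lz" "lx + ly + lz \<le> n"
      and p: "pos X = b" "pos Y = a + b" "pos Z = a"
      by (auto simp: triples_def)
    have "X \<otimes> ?T \<otimes> (Y \<otimes> ?T \<otimes> Z) \<in> \<B> (lx + t + (ly + t + lz))"
      using l t by (intro mult_ball)
    then show "?f x \<in> {x \<in> \<B> (n + 2 * t). pos x = 2 * (a + b) + 2 * (2 * c + 1)}"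
      using l(4) p by (auto simp: x elim!: ball_mono)
  qed
qed (simp add: finite_ball)

text \<open>Width is expressed by the existence of a factorization instead of by the chosen
  geodesic, so one element may be wide for several \<open>e\<close>.\<close>

definition wide where
  "wide e n = {g. \<exists>a b X Y Z. 0 \<le> a \<and> 0 \<le> b \<and> a + b = e \<and>
    (X, Y, Z) \<in> triples a b n \<and> g = inv Z \<otimes> Y \<otimes> inv X}"

lemma wide_subset_ball: "wide e n \<subseteq> \<B> n"
proof
  fix g assume "g \<in> wide e n"
  then obtain X Y Z lx ly lz where "X \<in> \<B> lx" "Y \<in> \<B> ly" "Z \<in> \<B> lz" "lx + ly + lz \<le> n"
    and g: "g = inv Z \<otimes> Y \<otimes> inv X"
    by (auto simp: wide_def triples_def)
  moreover from this have "g \<in> \<B> (lz + ly + lx)"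
    unfolding g by (intro mult_ball inv_ball)
  ultimately show "g \<in> \<B> n"
    by (auto elim!: ball_mono)
qed

text \<open>The factor \<open>Y\<close> has position \<open>e\<close> and length at most
  \<open>n\<close>. Hence for given \<open>n\<close> only finitely many widths
  \<open>e \<ge> E\<close> occur.\<close>

lemma wide_bound:
  assumes "g \<in> wide e n"
  shows "e \<le> c * int n"
proof -
  obtain Y l where "Y \<in> \<B> l" "pos Y = e" "l \<le> n"
    using assms by (auto simp: wide_def triples_def)
  then show ?thesis
    using pos_ball[of Y n] ball_mono by fastforce
qed

text \<open>Lamps inserted into two of the three factors cancel in \<open>inv Z \<otimes> Y \<otimes> inv X\<close>, so every wide
  element comes from quadratically many triples.\<close>

lemma many_triples:
  assumes "g \<in> wide e n"
  defines "d \<equiv> nat (e div 2)"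
  shows "(d + 1) choose 2 \<le>
    card {(X, Y, Z) \<in> (\<Union>a\<in>{0..e}. triples a (e - a) (n + 4 * C)). inv Z \<otimes> Y \<otimes> inv X = g}"
    (is "_ \<le> card ?P")
proof -
  obtain a b X Y Z where ab: "0 \<le> a" "0 \<le> b" "a + b = e"
    and m: "(X, Y, Z) \<in> triples a b n" and g: "g = inv Z \<otimes> Y \<otimes> inv X"
    using assms(1) by (auto simp: wide_def)
  obtain lx ly lz where l: "X \<in> \<B> lx" "Y \<in> \<B> ly" "Z \<in> \<B> lz" "lx + ly + lz \<le> n"
    and p: "pos X = b" "pos Y = a + b" "pos Z = a"
    using m by (auto simp: triples_def)
  have sX: "fst X i = \<one>\<^bsub>H\<^esub>" if "b + c < i" for i
    using m that by (auto simp: triples_def)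
  have sY: "fst Y i = \<one>\<^bsub>H\<^esub>" if "i < - c \<or> a + b + c < i" for i
    using m that by (auto simp: triples_def)
  have sZ: "fst Z i = \<one>\<^bsub>H\<^esub>" if "i < - c" for i
    using m that by (auto simp: triples_def)
  have cl [simp]: "X \<in> carrier G" "Y \<in> carrier G" "Z \<in> carrier G"
    using triples_closed[OF m] by auto
  \<comment> \<open>Two lamps are used because a single one would give only linearly many triples,
    which the \<open>e + 1\<close> values of \<open>a\<close> would use up.\<close>
  let ?D = "{A. A \<subseteq> {0..int d} \<and> card A = 2}"
  have fin: "finite A" if "A \<in> ?D" for A
    using that card.infinite by fastforce
  have finP: "finite ?P"
    by (rule finite_subset[of _ "\<Union>a\<in>{0..e}. triples a (e - a) (n + 4 * C)"])
      (auto simp: finite_triples)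
  have "card ?D = (d + 1) choose 2"
    using n_subsets[of "{0..int d}" 2] by (simp add: nat_add_distrib)
  \<comment> \<open>The larger of \<open>a\<close> and \<open>b\<close> is at least
    \<open>d\<close>, so on that side of the start there is room for the lamps.\<close>
  moreover have "card ?D \<le> card ?P"
  proof (cases "b \<le> a")
    case True
    then have d: "int d \<le> a"
      using ab by (auto simp: d_def)
    \<comment> \<open>\<open>Y\<close> and \<open>Z\<close> both begin at the left extreme, so a
      common left factor cancels in \<open>inv Z \<otimes> Y\<close>.\<close>
    let ?f = "\<lambda>A. (X, lamps H A h \<otimes> Y, lamps H A h \<otimes> Z)"
    show ?thesis
    proof (rule card_inj_on_le[where f = ?f])
      show "inj_on ?f ?D"
      proof (rule inj_onI)
        fix A A' assume A: "A \<in> ?D" "A' \<in> ?D" and "?f A = ?f A'"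
        then have "lamps H A h \<otimes> Y = lamps H A' h \<otimes> Y"
          by simp
        then have "lamps H A h = lamps H A' h"
          by (simp add: fin[OF A(1)] fin[OF A(2)])
        then show "A = A'" by (rule lamps_inject)
      qed
      show "?f ` ?D \<subseteq> ?P"
      proof (rule image_subsetI)
        fix A assume A: "A \<in> ?D"
        note finA = fin[OF A]
        have "lamps H A h \<otimes> Y \<in> \<B> (ly + 2 * C)" "lamps H A h \<otimes> Z \<in> \<B> (lz + 2 * C)"
          using lamps_mult_ball[OF finA l(2)] lamps_mult_ball[OF finA l(3)] A p d ab by force+
        moreover have "lx + (ly + 2 * C) + (lz + 2 * C) \<le> n + 4 * C"
          using l(4) by simp
        ultimately have "?f A \<in> triples a b (n + 4 * C)"
          unfolding triples_def using l(1) p A d ab c_nonneg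
          by (fastforce simp: fst_mult sX sY sZ)
        moreover have "inv (lamps H A h \<otimes> Z) \<otimes> (lamps H A h \<otimes> Y) \<otimes> inv X = g"
          using finA by (simp add: g inv_mult_group m_assoc inv_mult_cancel mult_inv_cancel)
        ultimately show "?f A \<in> ?P"
          using ab by (auto intro!: bexI[of _ a])
      qed
    qed (rule finP)
  next
    case False
    then have d: "int d \<le> b"
      using ab by (auto simp: d_def)
    \<comment> \<open>\<open>X\<close> and \<open>Y\<close> both end at the right extreme, so a
      common right factor cancels in \<open>Y \<otimes> inv X\<close>. Inversion makes this end the
      beginning, where \<open>lamps_mult_ball\<close> applies; the inverted walks run to the left,
      hence the negated positions.\<close>
    let ?L = "\<lambda>A. lamps H (uminus ` A) h"
    let ?f = "\<lambda>A. (inv (?L A \<otimes> inv X), inv (?L A \<otimes> inv Y), Z)"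
    show ?thesis
    proof (rule card_inj_on_le[where f = ?f])
      show "inj_on ?f ?D"
      proof (rule inj_onI)
        fix A A' assume A: "A \<in> ?D" "A' \<in> ?D" and "?f A = ?f A'"
        then have eq: "inv (?L A \<otimes> inv Y) = inv (?L A' \<otimes> inv Y)"
          by simp
        have "inv (inv (?L A \<otimes> inv Y)) = inv (inv (?L A' \<otimes> inv Y))"
          by (simp only: eq)
        then have "?L A = ?L A'"
          by (simp add: fin[OF A(1)] fin[OF A(2)])
        then have "uminus ` A = uminus ` A'" by (rule lamps_inject)
        then show "A = A'" by (simp add: inj_image_eq_iff)
      qed
      show "?f ` ?D \<subseteq> ?P"
      proof (rule image_subsetI)
        fix A assume A: "A \<in> ?D"
        have finA: "finite (uminus ` A)" and cardA: "card (uminus ` A) = 2"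
          using fin[OF A] A by (auto simp: card_image)
        have range: "- int d \<le> i \<and> i \<le> 0" if "i \<in> uminus ` A" for i
          using that A by auto
        have "?L A \<otimes> inv X \<in> \<B> (lx + card (uminus ` A) * C)"
             "?L A \<otimes> inv Y \<in> \<B> (ly + card (uminus ` A) * C)"
          using l(1,2) p d ab range by (intro lamps_mult_ball finA inv_ball; force)+
        then have "inv (?L A \<otimes> inv X) \<in> \<B> (lx + 2 * C)" "inv (?L A \<otimes> inv Y) \<in> \<B> (ly + 2 * C)"
          unfolding cardA by (auto intro: inv_ball)
        moreover have "(lx + 2 * C) + (ly + 2 * C) + lz \<le> n + 4 * C"
          using l(4) by simp
        moreover have "fst (inv (?L A \<otimes> inv X)) i = \<one>\<^bsub>H\<^esub>" if "b + c < i" for i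
          using range[of "i - b"] that c_nonneg finA p by (auto simp: fst_inv fst_mult sX)
        moreover have "fst (inv (?L A \<otimes> inv Y)) i = \<one>\<^bsub>H\<^esub>" if "i < - c \<or> a + b + c < i" for i
          using range[of "i - (a + b)"] that c_nonneg finA p d ab
          by (auto simp: fst_inv fst_mult sY)
        ultimately have "?f A \<in> triples a b (n + 4 * C)"
          unfolding triples_def using l(3) p finA by (fastforce simp: sZ)
        moreover have "inv Z \<otimes> inv (?L A \<otimes> inv Y) \<otimes> inv (inv (?L A \<otimes> inv X)) = g"
          using finA by (simp add: g inv_mult_group m_assoc inv_mult_cancel mult_inv_cancel)
        ultimately show "?f A \<in> ?P"
          using ab by (auto intro!: bexI[of _ a])
      qed
    qed (rule finP)
  qed
  ultimately show ?thesis by simp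
qed

text \<open>Double counting of triples over \<open>g = inv Z \<otimes> Y \<otimes> inv X\<close>:
  each fibre has at least about \<open>e^2 / 8\<close> elements, while each of the
  \<open>e + 1\<close> values of \<open>a\<close> contributes at most \<open>?k\<close> triples. The
  common factor \<open>e + 1\<close> is cancelled at the end.\<close>

lemma card_wide:
  assumes e: "1 \<le> e" and t: "shift H (2 * c + 1) \<in> \<B> t"
  shows "(e - 1) * int (card (wide e n)) \<le>
    8 * int (card {x \<in> \<B> (n + 4 * C + 2 * t). pos x = 2 * e + 2 * (2 * c + 1)})"
    (is "_ \<le> 8 * int ?k")
proof -
  define d where "d = nat (e div 2)"
  let ?U = "\<Union>a\<in>{0..e}. triples a (e - a) (n + 4 * C)"
  let ?P = "\<lambda>g. {(X, Y, Z) \<in> ?U. inv Z \<otimes> Y \<otimes> inv X = g}"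
  have finU: "finite ?U"
    by (simp add: finite_triples)
  have finP: "finite (?P g)" for g
    by (rule finite_subset[OF _ finU]) auto
  have finW: "finite (wide e n)"
    using wide_subset_ball finite_ball by (rule finite_subset)
  have "card (wide e n) * ((d + 1) choose 2) \<le> (\<Sum>g\<in>wide e n. card (?P g))"
    unfolding d_def using sum_bounded_below[of "wide e n" _ "\<lambda>g. card (?P g)"] many_triples by simp
  also have "\<dots> = card (\<Union>g\<in>wide e n. ?P g)"
    using finW finP by (subst card_UN_disjoint) auto
  also have "\<dots> \<le> card ?U"
    using finU by (intro card_mono) auto
  also have "\<dots> \<le> (\<Sum>a\<in>{0..e}. card (triples a (e - a) (n + 4 * C)))"
    by (rule card_UN_le) simp
  also have "\<dots> \<le> (\<Sum>a\<in>{0..e}. ?k)"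
  proof (rule sum_mono)
    fix a assume "a \<in> {0..e}"
    then show "card (triples a (e - a) (n + 4 * C)) \<le> ?k"
      using card_triples[OF _ _ t, of a "e - a" "n + 4 * C"] by simp
  qed
  finally have "card (wide e n) * ((d + 1) choose 2) \<le> nat (e + 1) * ?k"
    by simp
  then have "int (card (wide e n) * ((d + 1) choose 2)) \<le> int (nat (e + 1) * ?k)"
    by (simp only: of_nat_le_iff)
  then have "int (card (wide e n)) * int ((d + 1) choose 2) \<le> (e + 1) * int ?k"
    using e by simp
  \<comment> \<open>This follows from \<open>2 * d \<ge> e - 1\<close>, where equality holds for odd
    \<open>e\<close>.\<close>
  moreover have "(e - 1) * (e + 1) \<le> 8 * int ((d + 1) choose 2)"
  proof -
    have "2 * ((d + 1) choose 2) = d * (d + 1)"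
      by (induction d) (auto simp: numeral_2_eq_2)
    then have "int (2 * ((d + 1) choose 2)) = int (d * (d + 1))"
      by (simp only:)
    then have "2 * int ((d + 1) choose 2) = int d * (int d + 1)"
      by (simp only: of_nat_mult of_nat_add of_nat_numeral of_nat_1)
    moreover have "(2 * int d) * (2 * int d + 2) = 4 * (int d * (int d + 1))"
      by (simp add: algebra_simps)
    ultimately have "8 * int ((d + 1) choose 2) = (2 * int d) * (2 * int d + 2)"
      by linarith
    moreover have "(e - 1) * (e + 1) \<le> (2 * int d) * (2 * int d + 2)"
      using e by (intro mult_mono) (auto simp: d_def)
    ultimately show ?thesis by simp
  qed
  ultimately have "(e + 1) * ((e - 1) * int (card (wide e n))) \<le> (e + 1) * (8 * int ?k)"
    using mult_right_mono[of "(e - 1) * (e + 1)" "8 * int ((d + 1) choose 2)" "int (card (wide e n))"]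
    by (simp add: algebra_simps)
  then show ?thesis
    using e by (simp add: mult_le_cancel_left)
qed

text \<open>The sum over all widths costs no further factor, since the sets bounding different
  \<open>e\<close> lie in one ball and are told apart by their positions.\<close>

lemma card_wide_union:
  assumes E: "1 \<le> E" and t: "shift H (2 * c + 1) \<in> \<B> t"
  shows "(E - 1) * int (card (\<Union>e\<in>{E..}. wide e n)) \<le> 8 * int (card (\<B> (n + 4 * C + 2 * t)))"
proof -
  let ?I = "{E..c * int n}"
  let ?K = "\<lambda>e. {x \<in> \<B> (n + 4 * C + 2 * t). pos x = 2 * e + 2 * (2 * c + 1)}"
  have fin: "finite (wide e n)" for e
    using wide_subset_ball finite_ball by (rule finite_subset)
  have "(\<Union>e\<in>{E..}. wide e n) \<subseteq> (\<Union>e\<in>?I. wide e n)"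
    using wide_bound by fastforce
  then have "card (\<Union>e\<in>{E..}. wide e n) \<le> card (\<Union>e\<in>?I. wide e n)"
    using fin by (intro card_mono) auto
  also have "\<dots> \<le> (\<Sum>e\<in>?I. card (wide e n))"
    by (rule card_UN_le) simp
  finally have "(E - 1) * int (card (\<Union>e\<in>{E..}. wide e n)) \<le>
      (E - 1) * int (\<Sum>e\<in>?I. card (wide e n))"
    using E by (intro mult_left_mono) linarith+
  also have "\<dots> = (\<Sum>e\<in>?I. (E - 1) * int (card (wide e n)))"
    by (simp add: sum_distrib_left)
  also have "\<dots> \<le> (\<Sum>e\<in>?I. 8 * int (card (?K e)))"
  proof (rule sum_mono)
    fix e assume e: "e \<in> ?I"
    then have "(E - 1) * int (card (wide e n)) \<le> (e - 1) * int (card (wide e n))"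
      by (intro mult_right_mono) auto
    also have "\<dots> \<le> 8 * int (card (?K e))"
      using e E t by (intro card_wide) auto
    finally show "(E - 1) * int (card (wide e n)) \<le> 8 * int (card (?K e))" .
  qed
  also have "\<dots> = 8 * int (card (\<Union>e\<in>?I. ?K e))"
    by (subst card_UN_disjoint) (auto simp: finite_ball sum_distrib_left)
  also have "\<dots> \<le> 8 * int (card (\<B> (n + 4 * C + 2 * t)))"
    by (simp add: card_mono finite_ball UN_subset_iff)
  finally show ?thesis .
qed

section \<open>Base elements with a narrow walk\<close>

definition tour :: "int \<Rightarrow> int \<Rightarrow> (int \<Rightarrow> 'a) \<times> int \<Rightarrow> bool"
  where "tour a b g \<longleftrightarrow> (\<forall>j \<le> length (geodesic g).
    - a \<le> pos (prd (take j (geodesic g))) \<and> pos (prd (take j (geodesic g))) \<le> b)"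

lemma tour_supp:
  assumes "g \<in> carrier G" "tour a b g" "j \<le> length (geodesic g)" "i < - a - c \<or> b + c < i"
  shows "fst (prd (take j (geodesic g))) i = \<one>\<^bsub>H\<^esub>"
  using assms(2-4) by (intro supp_prefixes[OF geodesic(1)[OF assms(1)], of "- a" b]) (auto simp: tour_def)

lemma wide_or_narrow:
  assumes g: "g \<in> \<B> n" and pos_g: "pos g = 0"
  shows "tour E E g \<or> (\<exists>e\<ge>E. g \<in> wide e n) \<or> (\<exists>e\<ge>E. inv g \<in> wide e n)"
proof -
  have gG: "g \<in> carrier G"
    using g ball_carrier by blast
  let ?l = "length (geodesic g)"
  let ?P = "\<lambda>j. prd (take j (geodesic g))"
  note gens = geodesic(1)[OF gG]
  have PG [simp]: "?P j \<in> carrier G" for j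
    using set_take_gens[OF gens] by simp
  have Pl: "?P ?l = g"
    using geodesic(2)[OF gG] by simp
  have l: "?l \<le> n"
    using g geodesic(3)[OF gG] by (simp add: word_ball_def)
  \<comment> \<open>Segments may also be read backwards, as some of the pieces are reversed.\<close>
  have seg: "inv (?P j) \<otimes> ?P k \<in> \<B> (nat \<bar>int k - int j\<bar>)" if "j \<le> ?l" "k \<le> ?l" for j k
  proof (cases "j \<le> k")
    case True
    then show ?thesis
      using word_segment_ball[OF gens, of j k] that by (simp add: nat_diff_distrib)
  next
    case False
    then have "inv (inv (?P k) \<otimes> ?P j) \<in> \<B> (j - k)"
      using word_segment_ball[OF gens, of k j] that by (simp add: inv_ball)
    then show ?thesis
      using False by (simp add: inv_mult_group nat_diff_distrib)
  qed
  obtain i where i: "i \<le> ?l" "\<And>j. j \<le> ?l \<Longrightarrow> pos (?P i) \<le> pos (?P j)"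
    using ex_min_if_finite[of "{..?l}"] arg_min_if_finite[of "{..?l}" "\<lambda>j. pos (?P j)"]
    by (metis atMost_iff finite_atMost empty_iff order_refl linorder_not_less)
  obtain j where j: "j \<le> ?l" "\<And>k. k \<le> ?l \<Longrightarrow> pos (?P k) \<le> pos (?P j)"
    using arg_min_if_finite[of "{..?l}" "\<lambda>j. - pos (?P j)"]
    by (metis atMost_iff finite_atMost empty_iff order_refl linorder_not_less neg_less_iff_less)
  define a where "a = - pos (?P i)"
  define b where "b = pos (?P j)"
  have ab: "0 \<le> a" "0 \<le> b"
    using i(2)[of 0] j(2)[of 0] by (auto simp: a_def b_def)
  have tour: "tour a b g"
    using i j by (auto simp: tour_def a_def b_def)
  show ?thesis
  proof (cases "a + b < E")
    case True
    then have "tour E E g"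
      using tour ab unfolding tour_def by (smt (verit))
    then show ?thesis ..
  next
    case False
    have supp: "fst (inv (?P k) \<otimes> ?P m) x = \<one>\<^bsub>H\<^esub>"
      if "k \<le> ?l" "m \<le> ?l" "x + pos (?P k) < - a - c \<or> b + c < x + pos (?P k)" for k m x
      using tour_supp[OF gG tour that(1) that(3)] tour_supp[OF gG tour that(2) that(3)]
      by (simp add: fst_mult fst_inv)
    \<comment> \<open>Here \<open>k\<close> and \<open>m\<close> stand for the two ends of the word,
      in an order depending on which extreme is reached first. In both cases the three pieces tile
      the geodesic, so their lengths add up to at most \<open>n\<close>.\<close>
    have triple: "(inv (?P k) \<otimes> ?P j, inv (?P i) \<otimes> ?P j, inv (?P i) \<otimes> ?P m) \<in> triples a b n"
      if "k \<le> ?l" "m \<le> ?l" "pos (?P k) = 0" "pos (?P m) = 0"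
        "\<bar>int j - int k\<bar> + \<bar>int j - int i\<bar> + \<bar>int m - int i\<bar> \<le> int n" for k m
    proof -
      have "nat \<bar>int j - int k\<bar> + nat \<bar>int j - int i\<bar> + nat \<bar>int m - int i\<bar> \<le> n"
        using that(5) by linarith
      moreover note seg[OF that(1) j(1)] seg[OF i(1) j(1)] seg[OF i(1) that(2)]
      moreover have "\<forall>x. b + c < x \<longrightarrow> fst (inv (?P k) \<otimes> ?P j) x = \<one>\<^bsub>H\<^esub>"
        using that by (auto intro!: supp j)
      moreover have "\<forall>x. x < - c \<or> a + b + c < x \<longrightarrow> fst (inv (?P i) \<otimes> ?P j) x = \<one>\<^bsub>H\<^esub>"
        using i(1) j(1) by (auto intro!: supp simp: a_def)
      moreover have "\<forall>x. x < - c \<longrightarrow> fst (inv (?P i) \<otimes> ?P m) x = \<one>\<^bsub>H\<^esub>"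
        using i(1) that(2) by (auto intro!: supp simp: a_def)
      ultimately show ?thesis
        unfolding triples_def using that(3,4) by (auto simp: a_def b_def)
    qed
    show ?thesis
    proof (cases "i \<le> j")
      case True
      have "(inv (?P ?l) \<otimes> ?P j, inv (?P i) \<otimes> ?P j, inv (?P i) \<otimes> ?P 0) \<in> triples a b n"
        using True i(1) j(1) l Pl pos_g by (intro triple) auto
      moreover have "inv (inv (?P i) \<otimes> ?P 0) \<otimes> (inv (?P i) \<otimes> ?P j) \<otimes> inv (inv (?P ?l) \<otimes> ?P j) = g"
        using gG by (simp add: geodesic(2)[OF gG] inv_mult_group m_assoc inv_mult_cancel mult_inv_cancel)
      ultimately have "g \<in> wide (a + b) n"
        unfolding wide_def using ab by (smt (verit) mem_Collect_eq)
      then show ?thesis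
        using False by (meson linorder_not_less)
    next
      case ji: False
      have "(inv (?P 0) \<otimes> ?P j, inv (?P i) \<otimes> ?P j, inv (?P i) \<otimes> ?P ?l) \<in> triples a b n"
        using ji i(1) j(1) l Pl pos_g by (intro triple) auto
      moreover have "inv (inv (?P i) \<otimes> ?P ?l) \<otimes> (inv (?P i) \<otimes> ?P j) \<otimes> inv (inv (?P 0) \<otimes> ?P j) = inv g"
        using gG by (simp add: geodesic(2)[OF gG] inv_mult_group m_assoc inv_mult_cancel mult_inv_cancel)
      ultimately have "inv g \<in> wide (a + b) n"
        unfolding wide_def using ab by (smt (verit) mem_Collect_eq)
      then show ?thesis
        using False by (meson linorder_not_less)
    qed
  qed
qed

definition narrow where
  "narrow E L n = {g \<in> \<B> n. pos g = 0 \<and> tour E E g \<and> L \<le> word_length G S g}"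

text \<open>The pairs \<open>(g, j)\<close> with \<open>j \<le> L\<close> are counted. The first
  factor of the separated product determines \<open>j\<close>, since distinct prefixes of a geodesic
  have distinct products.\<close>

lemma card_narrow:
  assumes t: "shift H (4 * E + 2 * c + 1) \<in> \<B> t"
  shows "card (narrow E L n) * (L + 1) \<le> nat (2 * E + 1) * card (\<B> (n + t))"
proof -
  let ?P = "\<lambda>g j. prd (take j (geodesic g))"
  let ?T = "shift H (4 * E + 2 * c + 1)"
  \<comment> \<open>Recording the position of the cut makes the map injective; its
    \<open>2 * E + 1\<close> possible values are the multiplicity.\<close>
  let ?f = "\<lambda>(g, j). (pos (?P g j), ?P g j \<otimes> ?T \<otimes> (inv (?P g j) \<otimes> g))"
  have N: "g \<in> \<B> n" "g \<in> carrier G" "pos g = 0" "tour E E g" "L \<le> length (geodesic g)"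
      "length (geodesic g) \<le> n" "?P g (length (geodesic g)) = g" "?P g j \<in> carrier G"
    if "g \<in> narrow E L n" for g j
  proof -
    show *: "g \<in> \<B> n" "g \<in> carrier G" "pos g = 0" "tour E E g"
      using that ball_carrier[of g n] by (auto simp: narrow_def)
    show "L \<le> length (geodesic g)" "length (geodesic g) \<le> n" "?P g (length (geodesic g)) = g"
      "?P g j \<in> carrier G"
      using that geodesic[OF *(2)] set_take_gens[of "geodesic g" j]
      by (auto simp: narrow_def word_ball_def)
  qed
  have "card (narrow E L n \<times> {0..L}) \<le> card ({- E..E} \<times> \<B> (n + t))"
  proof (rule card_inj_on_le[where f = ?f])
    show "inj_on ?f (narrow E L n \<times> {0..L})"
    proof (rule inj_onI)
      fix x y
      assume xy: "x \<in> narrow E L n \<times> {0..L}" "y \<in> narrow E L n \<times> {0..L}" "?f x = ?f y"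
      obtain g j g' j' where x: "x = (g, j)" and y: "y = (g', j')"
        by (metis prod.exhaust)
      have g: "g \<in> narrow E L n" "g' \<in> narrow E L n" and j: "j \<in> {0..L}" "j' \<in> {0..L}"
        and pos: "pos (?P g j) = pos (?P g' j')"
        and eq: "?P g j \<otimes> ?T \<otimes> (inv (?P g j) \<otimes> g) = ?P g' j' \<otimes> ?T \<otimes> (inv (?P g' j') \<otimes> g')"
        using xy by (simp_all add: x y)
      have bd: "\<bar>pos (?P g j)\<bar> \<le> E" if "g \<in> narrow E L n" "j \<in> {0..L}" for g j
      proof -
        have "- E \<le> pos (?P g j) \<and> pos (?P g j) \<le> E"
          using that(2) N(4,5)[OF that(1)] by (auto simp: tour_def)
        then show ?thesis by linarith
      qed
      have sX: "fst (?P g j) x = \<one>\<^bsub>H\<^esub>" if "g \<in> narrow E L n" "j \<in> {0..L}" "E + c < x" for g j x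
        using that N(5)[OF that(1)] by (intro tour_supp[OF N(2,4)[OF that(1)]]) auto
      \<comment> \<open>Moving the origin to the cut shifts the lamps by at most \<open>E\<close>,
        which turns the bound \<open>- E - c\<close> into \<open>- 2 * E - c\<close>.\<close>
      have sY: "fst (inv (?P g j) \<otimes> g) x = \<one>\<^bsub>H\<^esub>"
        if "g \<in> narrow E L n" "j \<in> {0..L}" "x < - 2 * E - c" for g j x
      proof -
        have x: "x + pos (?P g j) < - E - c"
          using bd[OF that(1,2)] that(3) by linarith
        have "fst (?P g j) (x + pos (?P g j)) = \<one>\<^bsub>H\<^esub>"
          using that N(5)[OF that(1)] x by (intro tour_supp[OF N(2,4)[OF that(1)]]) auto
        moreover have "fst g (x + pos (?P g j)) = \<one>\<^bsub>H\<^esub>"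
          using tour_supp[OF N(2,4)[OF that(1)] order_refl] x N(7)[OF that(1)] by auto
        ultimately show ?thesis
          using N(8)[OF that(1)] by (simp add: fst_mult fst_inv)
      qed
      \<comment> \<open>The gap is chosen for the worst position \<open>- E\<close> of the cut:
        \<open>E + c < - E + (4 * E + 2 * c + 1) + (- 2 * E - c)\<close>.\<close>
      have "?P g j = ?P g' j' \<and> inv (?P g j) \<otimes> g = inv (?P g' j') \<otimes> g'"
        using g j pos bd[OF g(1) j(1)] c_nonneg N(2,8)[OF g(1)] N(2,8)[OF g(2)]
        by (intro separated_product_cancel[where r = "E + c" and r' = "- 2 * E - c"
              and M = "4 * E + 2 * c + 1"] eq sX sY) auto
      then have gg: "g = g'" and "?P g j = ?P g' j'"
        using N(2,8)[OF g(1)] N(2,8)[OF g(2)] by auto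
      then have "j = j'"
        using j N(5)[OF g(1)] geodesic(3)[OF N(2)[OF g(1)]]
        by (intro geodesic_prefix_inj[OF N(2)[OF g(1)]]) auto
      then show "x = y"
        using gg by (simp add: x y)
    qed
    show "?f ` (narrow E L n \<times> {0..L}) \<subseteq> {- E..E} \<times> \<B> (n + t)"
    proof (rule image_subsetI)
      fix x
      assume "x \<in> narrow E L n \<times> {0..L}"
      then obtain g j where x: "x = (g, j)" and g: "g \<in> narrow E L n" and j: "j \<in> {0..L}"
        by blast
      have jl: "j \<le> length (geodesic g)"
        using j N(5)[OF g] by simp
      have gens: "set (geodesic g) \<subseteq> gens G S"
        using geodesic(1)[OF N(2)[OF g]] .
      have "?P g j \<in> \<B> j"
        using word_prod_ball[OF set_take_gens[OF gens], of j] jl by (simp add: min.absorb2)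
      moreover have "inv (?P g j) \<otimes> g \<in> \<B> (length (geodesic g) - j)"
        using word_segment_ball[OF gens jl order_refl] N(7)[OF g] by simp
      ultimately have "?P g j \<otimes> ?T \<otimes> (inv (?P g j) \<otimes> g) \<in> \<B> (j + t + (length (geodesic g) - j))"
        using t by (intro mult_ball)
      then have "?P g j \<otimes> ?T \<otimes> (inv (?P g j) \<otimes> g) \<in> \<B> (n + t)"
        by (rule ball_mono) (use jl N(6)[OF g] in simp)
      then show "?f x \<in> {- E..E} \<times> \<B> (n + t)"
        using N(4)[OF g] jl by (auto simp: x tour_def)
    qed
  qed (simp add: finite_ball)
  then show ?thesis
    by (simp add: card_cartesian_product add.commute)
qed

section \<open>Growth and centralizers\<close>

text \<open>One lamp and a final position can be chosen independently, each in linearly many ways.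
  This growth beats the linear bound for centralizers.\<close>

lemma ball_card_quadratic: "\<exists>D. \<forall>n. n ^ 2 \<le> D ^ 2 * card (\<B> n)"
proof -
  obtain t where t: "shift H 1 \<in> \<B> t"
    using ex_ball[OF shift_closed] by blast
  have shift: "shift H (int j) \<in> \<B> (j * t)" for j
  proof (induction j)
    case 0
    have "shift H 0 = \<one>"
      by (rule wreath_eqI) auto
    then show ?case by (simp add: one_ball)
  next
    case (Suc j)
    then show ?case
      using mult_ball[OF t Suc] shift_add[of 1 "int j"] by simp
  qed
  \<comment> \<open>For \<open>k > 0\<close>, length \<open>k * D\<close> has room for
    \<open>2 * k\<close> unit shifts and one lamp; the summand 1 keeps \<open>D\<close>
    positive.\<close>
  define D where "D = 2 * t + C + 1"
  have "n ^ 2 \<le> D ^ 2 * card (\<B> n)" for n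
  proof -
    define k where "k = n div D"
    have n: "k * D \<le> n" "n \<le> (k + 1) * D"
      using div_times_less_eq_dividend[of n D] dividend_less_div_times[of D n]
      by (auto simp: k_def D_def algebra_simps)
    have k: "(k + 1) ^ 2 \<le> card (\<B> n)"
    proof (cases k)
      case 0
      then show ?thesis using card_ball_pos[of n] by simp
    next
      case (Suc k')
      let ?f = "\<lambda>(i, j). lamps H {int i} h \<otimes> shift H (int j)"
      \<comment> \<open>Final positions start at \<open>k\<close>, so that the walk passes every
        lamp site in \<open>0..k\<close>.\<close>
      have "card ({0..k} \<times> {k..2 * k}) \<le> card (\<B> n)"
      proof (rule card_inj_on_le[where f = ?f])
        show "inj_on ?f ({0..k} \<times> {k..2 * k})"
        proof (rule inj_onI, clarify)
          fix i j i' j'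
          assume eq: "lamps H {int i} h \<otimes> shift H (int j) = lamps H {int i'} h \<otimes> shift H (int j')"
          have j: "j = j'"
            using arg_cong[OF eq, of pos] by simp
          have "lamps H {int i} h = lamps H {int i'} h"
            using eq unfolding j by simp
          then show "i = i' \<and> j = j'"
            using j lamps_inject by fastforce
        qed
        show "?f ` ({0..k} \<times> {k..2 * k}) \<subseteq> \<B> n"
        proof (rule image_subsetI)
          fix x assume "x \<in> {0..k} \<times> {k..2 * k}"
          then obtain i j where x: "x = (i, j)" and "i \<in> {0..k}" "j \<in> {k..2 * k}"
            by blast
          then have "lamps H {int i} h \<otimes> shift H (int j) \<in> \<B> (j * t + C)"
            by (intro lamp_mult_ball shift) auto
          moreover have "j * t + C \<le> n"
          proof -
            have "j * t \<le> 2 * k * t"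
              using \<open>j \<in> _\<close> by simp
            moreover have "C \<le> k * C"
              using Suc by simp
            moreover have "k * D = 2 * k * t + k * C + k"
              by (simp add: D_def algebra_simps)
            ultimately have "j * t + C \<le> k * D"
              by linarith
            then show ?thesis using n by simp
          qed
          ultimately have "lamps H {int i} h \<otimes> shift H (int j) \<in> \<B> n"
            by (rule ball_mono)
          then show "?f x \<in> \<B> n"
            by (simp add: x)
        qed
      qed (rule finite_ball)
      then show ?thesis
        by (simp add: card_cartesian_product power2_eq_square)
    qed
    have "n ^ 2 \<le> ((k + 1) * D) ^ 2"
      using n(2) by (rule power_mono) simp
    also have "\<dots> = D ^ 2 * (k + 1) ^ 2"
      by (simp only: power_mult_distrib mult.commute)
    also have "\<dots> \<le> D ^ 2 * card (\<B> n)"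
      using k by (rule mult_le_mono2)
    finally show ?thesis .
  qed
  then show ?thesis by blast
qed

text \<open>Comparing coordinates shows that the finite support of \<open>x\<close> is mapped into
  itself by the translation by \<open>- pos g\<close>. A nonempty finite set of integers admits no
  such nonzero translation.\<close>

lemma centralizer_base_trivial:
  assumes "g \<in> carrier G" "x \<in> carrier G" "pos g \<noteq> 0" "pos x = 0"
    and comm: "g \<otimes> x = x \<otimes> g"
  shows "x = \<one>"
proof -
  define A where "A = {i. fst x i \<noteq> \<one>\<^bsub>H\<^esub>}"
  have fin: "finite A"
    using assms(2) by (simp add: A_def mem_G_iff)
  have step: "i - pos g \<in> A" if "i \<in> A" for i
  proof (rule ccontr)
    assume "i - pos g \<notin> A"
    then have "fst x (i - pos g) = \<one>\<^bsub>H\<^esub>"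
      by (simp add: A_def)
    moreover have "fst g i \<otimes>\<^bsub>H\<^esub> fst x (i - pos g) = fst x i \<otimes>\<^bsub>H\<^esub> fst g (i - pos x)"
      using comm fst_mult[of g x i] fst_mult[of x g i] by simp
    ultimately have "fst g i = fst x i \<otimes>\<^bsub>H\<^esub> fst g i"
      using assms(1,2,4) by simp
    then have "fst x i = \<one>\<^bsub>H\<^esub>"
      using assms(1,2) by (metis H.r_cancel_one' fst_closed)
    then show False
      using that by (simp add: A_def)
  qed
  have "A = {}"
  proof (rule ccontr)
    assume "A \<noteq> {}"
    then have "Min A - pos g \<in> A" "Max A - pos g \<in> A"
      using fin step by auto
    then have "Min A \<le> Min A - pos g" "Max A - pos g \<le> Max A"
      using fin by auto
    then show False
      using assms(3) by simp
  qed
  then show ?thesis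
    using assms(4) by (intro wreath_eqI) (auto simp: A_def)
qed

text \<open>Two elements of the centralizer with the same position differ by a base element of the
  centralizer, which is trivial. So \<open>pos\<close> is injective on the set, with values between
  \<open>- c * n\<close> and \<open>c * n\<close>.\<close>

lemma card_commuting_ball:
  assumes g: "g \<in> carrier G" "pos g \<noteq> 0"
  shows "card {x \<in> \<B> n. g \<otimes> x = x \<otimes> g} \<le> nat (2 * c * int n + 1)"
proof -
  let ?A = "{x \<in> \<B> n. g \<otimes> x = x \<otimes> g}"
  have "inj_on pos ?A"
  proof (rule inj_onI)
    fix x y assume xy: "x \<in> ?A" "y \<in> ?A" "pos x = pos y"
    then have cl: "x \<in> carrier G" "y \<in> carrier G"
      using ball_carrier[of x n] ball_carrier[of y n] by auto
    have "inv x \<otimes> (x \<otimes> g) \<otimes> inv x = inv x \<otimes> (g \<otimes> x) \<otimes> inv x"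
      using xy(1) by simp
    then have gx: "g \<otimes> inv x = inv x \<otimes> g"
      using g(1) cl by (simp add: m_assoc inv_mult_cancel)
    have "g \<otimes> (inv x \<otimes> y) = g \<otimes> inv x \<otimes> y"
      using g(1) cl by (simp add: m_assoc)
    also have "\<dots> = inv x \<otimes> (g \<otimes> y)"
      using g(1) cl by (simp add: gx m_assoc)
    also have "\<dots> = inv x \<otimes> y \<otimes> g"
      using xy(2) g(1) cl by (simp add: m_assoc)
    finally have "g \<otimes> (inv x \<otimes> y) = inv x \<otimes> y \<otimes> g" .
    then have "inv x \<otimes> y = \<one>"
      using g cl xy(3) by (intro centralizer_base_trivial[of g]) auto
    then show "x = y"
      using mult_inv_cancel[OF cl] cl by simp
  qed
  moreover have "pos ` ?A \<subseteq> {- (c * int n)..c * int n}"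
    using pos_ball by (fastforce simp: abs_le_iff)
  ultimately have "card ?A \<le> card {- (c * int n)..c * int n}"
    by (intro card_inj_on_le) auto
  then show ?thesis
    by (simp add: algebra_simps)
qed

section \<open>Densities\<close>

definition base_ball :: "nat \<Rightarrow> ((int \<Rightarrow> 'a) \<times> int) set"
  where "base_ball n = {g \<in> \<B> n. pos g = 0}"

text \<open>A base element is short, or narrow and long, or wide, or inverse to a wide one. The last
  two kinds double the factor 8 to 16.\<close>

lemma card_base_ball:
  assumes E: "2 \<le> E" and t: "shift H (2 * c + 1) \<in> \<B> t" and u: "shift H (4 * E + 2 * c + 1) \<in> \<B> u"
  shows "real (card (base_ball n)) \<le> real (card (\<B> L)) +
    real_of_int (2 * E + 1) * real (card (\<B> u)) * real (card (\<B> n)) / real (L + 1) +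
    16 * real (card (\<B> (4 * C + 2 * t))) * real (card (\<B> n)) / real_of_int (E - 1)"
proof -
  let ?W = "\<Union>e\<in>{E..}. wide e n"
  have finW: "finite ?W"
    using wide_subset_ball by (intro finite_subset[OF _ finite_ball[of n]]) auto
  have W: "real (card ?W) \<le> 8 * real (card (\<B> (4 * C + 2 * t))) * real (card (\<B> n)) / real_of_int (E - 1)"
  proof -
    have "(E - 1) * int (card ?W) \<le> 8 * int (card (\<B> (n + (4 * C + 2 * t))))"
      using card_wide_union[OF _ t, of E n] E by (simp add: add.assoc)
    also have "\<dots> \<le> 8 * int (card (\<B> n) * card (\<B> (4 * C + 2 * t)))"
      using card_ball_add[of n "4 * C + 2 * t"] by (simp only: of_nat_le_iff mult_le_cancel_left) simp
    finally have "real_of_int ((E - 1) * int (card ?W)) \<le>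
        real_of_int (8 * int (card (\<B> n) * card (\<B> (4 * C + 2 * t))))"
      by (simp only: of_int_le_iff)
    then show ?thesis
      using E by (simp add: field_simps)
  qed
  have N: "real (card (narrow E L n)) \<le>
      real_of_int (2 * E + 1) * real (card (\<B> u)) * real (card (\<B> n)) / real (L + 1)"
  proof -
    have "card (narrow E L n) * (L + 1) \<le> nat (2 * E + 1) * (card (\<B> n) * card (\<B> u))"
      using card_narrow[OF u, of L n] card_ball_add[of n u] by (meson le_trans mult_le_mono2)
    then have "real (card (narrow E L n) * (L + 1)) \<le> real (nat (2 * E + 1) * (card (\<B> n) * card (\<B> u)))"
      by (simp only: of_nat_le_iff)
    then show ?thesis
      using E by (simp add: field_simps)
  qed
  have "base_ball n \<subseteq> \<B> L \<union> narrow E L n \<union> ?W \<union> m_inv G ` ?W"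
  proof
    fix g assume g: "g \<in> base_ball n"
    then have gB: "g \<in> \<B> n" "pos g = 0"
      by (auto simp: base_ball_def)
    then have gG: "g \<in> carrier G"
      using ball_carrier by blast
    consider "tour E E g" | "g \<in> ?W" | "inv g \<in> ?W"
      using wide_or_narrow[OF gB, of E] by auto
    then show "g \<in> \<B> L \<union> narrow E L n \<union> ?W \<union> m_inv G ` ?W"
    proof cases
      case 1
      then show ?thesis
        using gB gG by (auto simp: narrow_def word_ball_def)
    next
      case 3
      then have "inv (inv g) \<in> m_inv G ` ?W"
        by (rule imageI)
      then show ?thesis using gG by simp
    qed blast
  qed
  then have "card (base_ball n) \<le> card (\<B> L \<union> narrow E L n \<union> ?W \<union> m_inv G ` ?W)"
    using finW by (intro card_mono) (auto simp: finite_ball narrow_def)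
  also have "\<dots> \<le> card (\<B> L) + card (narrow E L n) + card ?W + card (m_inv G ` ?W)"
    by (meson card_Un_le le_trans add_le_mono1)
  also have "card (m_inv G ` ?W) \<le> card ?W"
    using finW by (rule card_image_le)
  finally have "card (base_ball n) \<le> card (\<B> L) + card (narrow E L n) + 2 * card ?W"
    by simp
  then have "real (card (base_ball n)) \<le> real (card (\<B> L) + card (narrow E L n) + 2 * card ?W)"
    by (simp only: of_nat_le_iff)
  then show ?thesis
    using W N by simp
qed

lemma ball_card_inverse: "(\<lambda>n. K / real (card (\<B> n))) \<longlonglongrightarrow> 0"
  and ball_card_superlinear: "(\<lambda>n. real n / real (card (\<B> n))) \<longlonglongrightarrow> 0"
proof -
  obtain D where D: "n ^ 2 \<le> D ^ 2 * card (\<B> n)" for n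
    using ball_card_quadratic by blast
  \<comment> \<open>At \<open>n = 0\<close> both sides are 0, the right one by the convention for
    division by zero.\<close>
  have bound: "real n / real (card (\<B> n)) \<le> real (D ^ 2) / real n" for n
  proof (cases "n = 0")
    case False
    have "real (n ^ 2) \<le> real (D ^ 2 * card (\<B> n))"
      using D[of n] by (simp only: of_nat_le_iff)
    then show ?thesis
      using False card_ball_pos[of n] by (simp add: field_simps power2_eq_square)
  qed simp
  show 1: "(\<lambda>n. real n / real (card (\<B> n))) \<longlonglongrightarrow> 0"
    by (rule tendsto_sandwich[OF _ _ tendsto_const lim_const_over_n[of "real (D ^ 2)"]])
      (use bound in auto)
  have "(\<lambda>n. 1 / real (card (\<B> n))) \<longlonglongrightarrow> 0"
    by (rule tendsto_sandwich[OF _ _ tendsto_const 1])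
      (auto intro!: eventually_sequentiallyI[of 1] divide_right_mono)
  then have "(\<lambda>n. K * (1 / real (card (\<B> n)))) \<longlonglongrightarrow> K * 0"
    by (rule tendsto_mult_left)
  then show "(\<lambda>n. K / real (card (\<B> n))) \<longlonglongrightarrow> 0"
    by simp
qed

text \<open>The order of choices matters: \<open>A\<close> does not depend on \<open>E\<close>, so
  \<open>E\<close> comes first; \<open>u\<close> and \<open>A'\<close> depend on \<open>E\<close>,
  and \<open>L\<close> is chosen after them; finally \<open>n\<close> makes the ball of radius
  \<open>L\<close> negligible. Each of the three terms is then below \<open>r / 3\<close>.\<close>

lemma base_density_zero: "(\<lambda>n. real (card (base_ball n)) / real (card (\<B> n))) \<longlonglongrightarrow> 0"
proof (rule LIMSEQ_I)
  fix r :: real assume r: "0 < r"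
  obtain t where t: "shift H (2 * c + 1) \<in> \<B> t"
    using ex_ball[OF shift_closed] by blast
  define A where "A = 16 * real (card (\<B> (4 * C + 2 * t)))"
  define E where "E = 2 + \<lceil>3 * A / r\<rceil>"
  have "0 \<le> 3 * A / r"
    using r by (simp add: A_def)
  then have E: "2 \<le> E"
    by (simp add: E_def)
  have "3 * A / r < real_of_int (E - 1)"
    unfolding E_def using le_of_int_ceiling[of "3 * A / r"] by linarith
  then have A: "A / real_of_int (E - 1) < r / 3"
    using E r by (simp add: field_simps)
  obtain u where u: "shift H (4 * E + 2 * c + 1) \<in> \<B> u"
    using ex_ball[OF shift_closed] by blast
  define A' where "A' = real_of_int (2 * E + 1) * real (card (\<B> u))"
  obtain L :: nat where L: "3 * A' / r < real L"
    using reals_Archimedean2 by blast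
  have A': "A' / real (L + 1) < r / 3"
    using L r by (simp add: field_simps)
  obtain n0 where n0: "\<And>n. n \<ge> n0 \<Longrightarrow> real (card (\<B> L)) / real (card (\<B> n)) < r / 3"
    using LIMSEQ_D[OF ball_card_inverse[of "real (card (\<B> L))"], of "r / 3"] r by auto
  have "norm (real (card (base_ball n)) / real (card (\<B> n)) - 0) < r" if "n \<ge> n0" for n
  proof -
    have b: "0 < real (card (\<B> n))"
      using card_ball_pos by simp
    have "real (card (base_ball n)) / real (card (\<B> n)) \<le>
        (real (card (\<B> L)) + A' * real (card (\<B> n)) / real (L + 1) +
          A * real (card (\<B> n)) / real_of_int (E - 1)) / real (card (\<B> n))"
      unfolding A_def A'_def using card_base_ball[OF E t u] by (rule divide_right_mono) simp
    also have "\<dots> = real (card (\<B> L)) / real (card (\<B> n)) + A' / real (L + 1) + A / real_of_int (E - 1)"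
      using b by (simp add: add_divide_distrib)
    also have "\<dots> < r"
      using n0[OF that] A A' by linarith
    finally show ?thesis by simp
  qed
  then show "\<exists>n0. \<forall>n\<ge>n0. norm (real (card (base_ball n)) / real (card (\<B> n)) - 0) < r"
    by blast
qed

lemma card_commuting_pairs:
  "card {(g, k) \<in> \<B> n \<times> \<B> n. g \<otimes> k = k \<otimes> g} \<le>
    card (base_ball n) ^ 2 + 2 * (card (\<B> n) * nat (2 * c * int n + 1))"
proof -
  let ?Q = "{(g, k) \<in> \<B> n \<times> \<B> n. g \<otimes> k = k \<otimes> g}"
  let ?R = "SIGMA g:{g \<in> \<B> n. pos g \<noteq> 0}. {x \<in> \<B> n. g \<otimes> x = x \<otimes> g}"
  have fin: "finite ?R"
    by (intro finite_SigmaI) (auto simp: finite_ball)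
  have "card ?R = (\<Sum>g\<in>{g \<in> \<B> n. pos g \<noteq> 0}. card {x \<in> \<B> n. g \<otimes> x = x \<otimes> g})"
    by (rule card_SigmaI) (auto simp: finite_ball)
  also have "\<dots> \<le> (\<Sum>g\<in>{g \<in> \<B> n. pos g \<noteq> 0}. nat (2 * c * int n + 1))"
    by (intro sum_mono card_commuting_ball) (simp_all add: ball_carrier[where n = n])
  also have "\<dots> = card {g \<in> \<B> n. pos g \<noteq> 0} * nat (2 * c * int n + 1)"
    by simp
  also have "\<dots> \<le> card (\<B> n) * nat (2 * c * int n + 1)"
    by (intro mult_le_mono1 card_mono finite_ball) auto
  finally have R: "card ?R \<le> card (\<B> n) * nat (2 * c * int n + 1)" .
  \<comment> \<open>A pair whose second entry lies outside the base is the swap of a pair in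
    \<open>?R\<close>.\<close>
  have "?Q \<subseteq> base_ball n \<times> base_ball n \<union> ?R \<union> prod.swap ` ?R"
  proof
    fix x assume x: "x \<in> ?Q"
    obtain g k where gk: "x = (g, k)"
      by (metis prod.exhaust)
    have m: "g \<in> \<B> n" "k \<in> \<B> n" "g \<otimes> k = k \<otimes> g"
      using x by (simp_all only: gk mem_Collect_eq case_prod_conv mem_Times_iff fst_conv snd_conv)
    consider "pos g \<noteq> 0" | "pos k \<noteq> 0" | "pos g = 0" "pos k = 0"
      by blast
    then show "x \<in> base_ball n \<times> base_ball n \<union> ?R \<union> prod.swap ` ?R"
    proof cases
      case 1
      then have "(g, k) \<in> ?R" using m by blast
      then show ?thesis unfolding gk by blast
    next
      case 2
      then have "(k, g) \<in> ?R" using m m(3)[symmetric] by blast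
      then have "prod.swap (k, g) \<in> prod.swap ` ?R" by (rule imageI)
      then show ?thesis by (simp only: gk swap_simp Un_iff simp_thms)
    next
      case 3
      then show ?thesis using m by (simp only: gk base_ball_def) blast
    qed
  qed
  then have "card ?Q \<le> card (base_ball n \<times> base_ball n \<union> ?R \<union> prod.swap ` ?R)"
    using fin by (intro card_mono) (auto simp: finite_ball base_ball_def)
  also have "\<dots> \<le> card (base_ball n \<times> base_ball n) + card ?R + card (prod.swap ` ?R)"
    by (meson card_Un_le le_trans add_le_mono1)
  also have "\<dots> \<le> card (base_ball n) ^ 2 + card ?R + card ?R"
    using card_image_le[OF fin, of prod.swap] by (simp add: card_cartesian_product power2_eq_square)
  finally show ?thesis
    using R by simp
qed

lemma commuting_density_zero:
  "(\<lambda>n. real (card {(g, k) \<in> \<B> n \<times> \<B> n. g \<otimes> k = k \<otimes> g}) / real (card (\<B> n)) ^ 2) \<longlonglongrightarrow> 0"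
proof (rule tendsto_sandwich[OF _ _ tendsto_const])
  let ?b = "\<lambda>n. real (card (\<B> n))"
  let ?f = "\<lambda>n. (real (card (base_ball n)) / ?b n) ^ 2 +
    (4 * real_of_int c * (real n / ?b n) + 2 / ?b n)"
  have "?f \<longlonglongrightarrow> 0 ^ 2 + (4 * real_of_int c * 0 + 0)"
    by (intro tendsto_add tendsto_power tendsto_mult tendsto_const base_density_zero
        ball_card_superlinear ball_card_inverse)
  then show "?f \<longlonglongrightarrow> 0" by simp
  show "\<forall>\<^sub>F n in sequentially.
      real (card {(g, k) \<in> \<B> n \<times> \<B> n. g \<otimes> k = k \<otimes> g}) / ?b n ^ 2 \<le> ?f n"
  proof (intro always_eventually allI)
    fix n
    have b: "0 < ?b n"
      using card_ball_pos by simp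
    have "real (card {(g, k) \<in> \<B> n \<times> \<B> n. g \<otimes> k = k \<otimes> g}) \<le>
        real (card (base_ball n) ^ 2 + 2 * (card (\<B> n) * nat (2 * c * int n + 1)))"
      using card_commuting_pairs by (simp only: of_nat_le_iff)
    also have "\<dots> = real (card (base_ball n)) ^ 2 + 2 * ?b n * (2 * real_of_int c * real n + 1)"
      using c_nonneg by simp
    finally have "real (card {(g, k) \<in> \<B> n \<times> \<B> n. g \<otimes> k = k \<otimes> g}) / ?b n ^ 2 \<le>
        (real (card (base_ball n)) ^ 2 + 2 * ?b n * (2 * real_of_int c * real n + 1)) / ?b n ^ 2"
      by (rule divide_right_mono) simp
    also have "\<dots> = ?f n"
      using b by (simp add: field_simps power2_eq_square)
    finally show "real (card {(g, k) \<in> \<B> n \<times> \<B> n. g \<otimes> k = k \<otimes> g}) / ?b n ^ 2 \<le> ?f n" .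
  qed
qed simp

end

section \<open>Existence of the constants and the conclusion\<close>

lemma (in wreath_generated) ex_bounds:
  assumes "h \<in> carrier H" "h \<noteq> \<one>\<^bsub>H\<^esub>"
  shows "\<exists>c C. wreath_bounded G S H c C h"
proof -
  \<comment> \<open>All displacements and lamp sites of the finitely many generators; finite because
    elements of \<open>G\<close> have finite support.\<close>
  define F where "F = (\<Union>s\<in>gens G S. insert (pos s) {i. fst s i \<noteq> \<one>\<^bsub>H\<^esub>})"
  have "finite F"
    unfolding F_def using finite_gens gens_carrier by (auto simp: mem_G_iff)
  \<comment> \<open>Inserting 0 makes the maximum nonnegative and meaningful even for an empty
    set.\<close>
  define c where "c = Max (insert 0 (abs ` F))"
  have c: "\<bar>i\<bar> \<le> c" if "i \<in> F" for i
    using that \<open>finite F\<close> by (simp add: c_def)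
  have "0 \<le> c"
    using \<open>finite F\<close> by (simp add: c_def)
  have "(\<lambda>i. lamps H {i} h) ` {- c..c} \<subseteq> carrier G"
    using assms(1) by auto
  then obtain C where C: "(\<lambda>i. lamps H {i} h) ` {- c..c} \<subseteq> \<B> C"
    using finite_subset_ball[of "(\<lambda>i. lamps H {i} h) ` {- c..c}"] by auto
  have "wreath_bounded G S H c C h"
  proof
    fix s i
    assume s: "s \<in> gens G S"
    show "\<bar>pos s\<bar> \<le> c"
      using s by (intro c) (auto simp: F_def)
    show "fst s i = \<one>\<^bsub>H\<^esub>" if "c < \<bar>i\<bar>"
    proof (rule ccontr)
      assume "fst s i \<noteq> \<one>\<^bsub>H\<^esub>"
      then have "i \<in> F"
        using s by (auto simp: F_def)
      then show False
        using c that by fastforce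
    qed
  next
    show "lamps H {i} h \<in> \<B> C" if "\<bar>i\<bar> \<le> c" for i
      using C that by (auto simp: abs_le_iff)
  qed (use assms \<open>0 \<le> c\<close> in auto)
  then show ?thesis by blast
qed

theorem theorem1:
  fixes H :: "('a, 'b) monoid_scheme"
    and S :: "((int \<Rightarrow> 'a) \<times> int) set"
  assumes "group H"
    and "finitely_generated H"
    and "carrier H \<noteq> {\<one>\<^bsub>H\<^esub>}"
    and "finite_generating_set (wreath_Z H) S"
  shows "degree_of_commutativity (wreath_Z H) S = 0"
proof -
  interpret H: group H by fact
  interpret G: group "wreath_Z H" by (rule group_wreath_Z) fact
  interpret wreath_generated "wreath_Z H" S H
    by unfold_locales (rule assms(1) assms(4) refl)+
  obtain h where "h \<in> carrier H" "h \<noteq> \<one>\<^bsub>H\<^esub>"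
    using assms(3) H.one_closed by blast
  then obtain c C where "wreath_bounded (wreath_Z H) S H c C h"
    using ex_bounds by blast
  then interpret wreath_bounded "wreath_Z H" S H c C h .
  show ?thesis
    unfolding degree_of_commutativity_def
    using commuting_density_zero
    by (intro lim_imp_Limsup) (simp_all add: zero_ereal_def)
qed

end
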